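(* Let $\rho$ be a probability distribution on $\mathcal S$, let $\pi^*$ be an optimal robust policy, and let $M=\sup_{u\in\mathcal U}\|d_\rho^{\pi^*,u}/\rho\|_\infty$ (finite whenever $\mathrm{supp}(\rho)=\mathcal S$; assume $M<\infty$). Let $(\pi_k)$ be generated by the stochastic robust policy mirror descent (SRPMD) method with distance-generating function $w(\cdot)=\|\cdot\|_2^2$ and constant stepsizes $\eta_k=\eta$, $k\ge0$, for some fixed $\eta>0$, and suppose $\mathbb E_{\xi_k}\|Q^{\pi_k,\xi_k}_r-Q^{\pi_k}_r\|_\infty\le e_k$ for all $k\ge0$. For any $k\ge1$, let $R$ be a random integer uniformly sampled from $\{1,\ldots,k\}$. Then $$\mathbb E\big[f_\rho(\pi_R)-f_\rho(\pi^* )\big]\le\frac{M}{(1-\gamma)k}\big(f_\rho(\pi_0)-f_\rho(\pi^* )\big)+\frac{4M}{(1-\gamma)^2k}\sum_{t=0}^{k-1}e_t+\sqrt{\frac{18|\mathcal S|^2}{k\eta(1-\gamma)^3}}\sqrt{1+2\sum_{t=0}^{k-1}e_t}.$$ In particular, if $\mathbb E_{\xi_k}\|Q^{\pi_k,\xi_k}_r-Q^{\pi_k}_r\|_\infty\le e$ for all $k\ge0$, then $$\mathbb E\big[f_\rho(\pi_R)-f_\rho(\pi^* )\big]\le\frac{M}{(1-\gamma)k}\big(f_\rho(\pi_0)-f_\rho(\pi^* )\big)+\frac{4Me}{(1-\gamma)^2}+\sqrt{\frac{18|\mathcal S|^2}{\eta k(1-\gamma)^3}}+\sqrt{\frac{36|\mathcal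 S|^2e}{\eta(1-\gamma)^3}}.$$
   Context: Robust MDP. $\mathcal S,\mathcal A$ are finite nonempty state and action sets, $c:\mathcal S\times\mathcal A\to\mathbb R$ is a cost with $0<c(s,a)\le1$, $\gamma\in(0,1)$ is the discount factor, and $\mathbb P_{N}$ is a nominal transition kernel ($\mathbb P_N(\cdot|s,a)\in\Delta_{\mathcal S}$, where $\Delta_{\mathcal X}$ is the probability simplex over $\mathcal X$). The uncertainty set $\mathcal U\subset\mathbb R^{|\mathcal S|\times|\mathcal S|\times|\mathcal A|}$ is nonempty, compact and $(s,a)$-rectangular: $\mathcal U=\prod_{s,a}\mathcal U_{s,a}$ with $\mathcal U_{s,a}=\{u(\cdot|s,a):u\in\mathcal U\}$; for every $u\in\mathcal U$, $\mathbb P_u(\cdot|s,a)=\mathbb P_N(\cdot|s,a)+u(\cdot|s,a)$ is a transition kernel. $\Pi$ is the set of stationary randomized policies ($\pi(\cdot|s)\in\Delta_{\mathcal A}$ for all $s$). Values. $V^\pi_u(s)=\mathbb E[\sum_{t\ge0}\gamma^t c(s_t,a_t)\mid s_0=s]$ with $a_t\sim\pi(\cdot|s_t)$, $s_{t+1}\sim\mathbb P_u(\cdot|s_t,a_t)$; $Q^\pi_u(s,a)$ is the same with in addition $a_0=a$. Robust values: $V^\pi_r(s)=\max_{u\in\mathcal U}V^\pi_u(s)$, $Q^\pi_r(s,a)=\max_{u\in\mathcal U}Q^\pi_u(s,a)$. Objective: $f_\rho(\pi)=\mathbb E_{s\sim\rho}[V^\pi_r(s)]$. An optimal robust policy $\pi^*$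 satisfies $V^{\pi^*}_r(s)\le V^\pi_r(s)$ for all $s\in\mathcal S$, $\pi\in\Pi$ (such a policy exists). Visitation measures: $d^{\pi,u}_s(s')=(1-\gamma)\sum_{t\ge0}\gamma^t\Pr(s_t=s'\mid s_0=s)$ under policy $\pi$ and kernel $\mathbb P_u$; $d^{\pi,u}_\rho(s')=\mathbb E_{s\sim\rho}d^{\pi,u}_s(s')$. Ratios of measures are taken entrywise. SRPMD with $w=\|\cdot\|_2^2$. Given $\pi_0\in\Pi$, at iteration $k$ a random estimate $Q^{\pi_k,\xi_k}_r\in\mathbb R^{|\mathcal S||\mathcal A|}$ of $Q^{\pi_k}_r$ is formed from random samples $\xi_k$, and for every $s\in\mathcal S$ $$\pi_{k+1}(\cdot|s)=\operatorname{argmin}_{p(\cdot|s)\in\Delta_{\mathcal A}}\ \eta_k\langle Q^{\pi_k,\xi_k}_r(s,\cdot),p(\cdot|s)\rangle+\|p(\cdot|s)-\pi_k(\cdot|s)\|_2^2.$$ $\mathbb E_{\xi_k}$ is expectation over $\xi_k$ conditionally on the past ($\pi_k$ given); $\mathbb E$ is over all samples and the independent index $R$. *)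

theory Defs
  imports "HOL-Probability.Probability"
begin

text \<open>
  States and actions are finite types \<open>'s\<close> and \<open>'a\<close>.  A policy \<open>\<pi>\<close> has entries
  \<open>\<pi> $ s $ a\<close> for \<open>\<pi>(a|s)\<close>; kernels and elements of the uncertainty set have entries
  \<open>P $ s $ a $ s'\<close> for \<open>P(s'|s,a)\<close>.
\<close>

type_synonym ('s, 'a) policy = "real^'a^'s"
type_synonym ('s, 'a) kernel = "real^'s^'a^'s"

definition prob_simplex :: "(real^'n) set" where
  "prob_simplex = {p. (\<forall>i. 0 \<le> p $ i) \<and> (\<Sum>i\<in>UNIV. p $ i) = 1}"

definition policies :: "('s::finite, 'a::finite) policy set" where
  "policies = {\<pi>. \<forall>s. \<pi> $ s \<in> prob_simplex}"

definition kernels :: "('s::finite, 'a::finite) kernel set" where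
  "kernels = {P. \<forall>s a. P $ s $ a \<in> prob_simplex}"

definition rectangular :: "('s::finite, 'a::finite) kernel set \<Rightarrow> bool" where
  "rectangular U \<longleftrightarrow> U = {u. \<forall>s a. u $ s $ a \<in> (\<lambda>v. v $ s $ a) ` U}"

locale robust_mdp =
  fixes c :: "'s::finite \<Rightarrow> 'a::finite \<Rightarrow> real"
    and \<gamma> :: real
    and PN :: "('s, 'a) kernel"
    and U :: "('s, 'a) kernel set"
  assumes cost: "0 < c s a" "c s a \<le> 1"
    and discount: "0 < \<gamma>" "\<gamma> < 1"
    and nominal: "PN \<in> kernels"
    and U_nonempty: "U \<noteq> {}"
    and U_compact: "compact U"
    and U_rectangular: "rectangular U"
    and U_kernels: "u \<in> U \<Longrightarrow> PN + u \<in> kernels"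

text \<open>
  The law of the state-action process \<open>(s\<^sub>t, a\<^sub>t)\<close> is the Ionescu-Tulcea measure on infinite
  sequences.  Its initial law \<open>\<nu>\<close> is a parameter, so that the same construction serves values
  started from a state and values started from a state-action pair.
\<close>

definition vec_pmf :: "real^'n \<Rightarrow> 'n::finite pmf" where
  "vec_pmf p = embed_pmf (\<lambda>i. p $ i)"

definition act :: "('s::finite, 'a::finite) policy \<Rightarrow> 's \<Rightarrow> ('s \<times> 'a) pmf" where
  "act \<pi> s = map_pmf (Pair s) (vec_pmf (\<pi> $ s))"

definition step ::
    "('s::finite, 'a::finite) kernel \<Rightarrow> ('s, 'a) policy \<Rightarrow> 's \<times> 'a \<Rightarrow> ('s \<times> 'a) pmf" where
  "step P \<pi> x = bind_pmf (vec_pmf (P $ fst x $ snd x)) (act \<pi>)"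

definition traj_kernel ::
    "('s::finite, 'a::finite) kernel \<Rightarrow> ('s, 'a) policy \<Rightarrow> ('s \<times> 'a) pmf
      \<Rightarrow> nat \<Rightarrow> (nat \<Rightarrow> 's \<times> 'a) \<Rightarrow> ('s \<times> 'a) measure" where
  "traj_kernel P \<pi> \<nu> t \<omega> =
     measure_pmf (case t of 0 \<Rightarrow> \<nu> | Suc t' \<Rightarrow> step P \<pi> (\<omega> t'))"

definition traj ::
    "('s::finite, 'a::finite) kernel \<Rightarrow> ('s, 'a) policy \<Rightarrow> ('s \<times> 'a) pmf
      \<Rightarrow> (nat \<Rightarrow> 's \<times> 'a) measure" where
  "traj P \<pi> \<nu> = projective_family.lim UNIV
     (Ionescu_Tulcea.CI (traj_kernel P \<pi> \<nu>) (\<lambda>_. count_space UNIV)) (\<lambda>_. count_space UNIV)"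

lemma Ionescu_Tulcea_traj_kernel:
  "Ionescu_Tulcea (traj_kernel P \<pi> \<nu>) (\<lambda>_. count_space UNIV)"
proof (rule Ionescu_Tulcea.intro)
  fix t
  show "traj_kernel P \<pi> \<nu> t
    \<in> measurable (PiM {0..<t} (\<lambda>_. count_space UNIV)) (subprob_algebra (count_space UNIV))"
  proof (cases t)
    case 0
    then show ?thesis
      by (simp add: traj_kernel_def[abs_def] measure_pmf_in_subprob_algebra)
  next
    case (Suc t')
    have "(\<lambda>\<omega>. \<omega> t') \<in> measurable (PiM {0..<t} (\<lambda>_. count_space UNIV))
        (count_space (UNIV :: ('a \<times> 'b) set))"
      using Suc by (intro measurable_component_singleton) auto
    moreover have "(\<lambda>x. measure_pmf (step P \<pi> x))
        \<in> measurable (count_space UNIV) (subprob_algebra (count_space UNIV))"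
      by (simp add: measure_pmf_in_subprob_algebra)
    ultimately have "(\<lambda>\<omega>. measure_pmf (step P \<pi> (\<omega> t')))
        \<in> measurable (PiM {0..<t} (\<lambda>_. count_space UNIV)) (subprob_algebra (count_space UNIV))"
      by (rule measurable_compose)
    then show ?thesis
      by (simp add: traj_kernel_def[abs_def] Suc)
  qed
next
  fix t \<omega>
  show "prob_space (traj_kernel P \<pi> \<nu> t \<omega>)"
    unfolding traj_kernel_def by (rule measure_pmf.prob_space_axioms)
qed

lemma prob_space_traj: "prob_space (traj P \<pi> \<nu>)"
proof -
  interpret IT: Ionescu_Tulcea "traj_kernel P \<pi> \<nu>" "\<lambda>_. count_space UNIV"
    by (rule Ionescu_Tulcea_traj_kernel)
  have "prob_space (distr (traj P \<pi> \<nu>) (PiM {} (\<lambda>_. count_space UNIV)) (\<lambda>x. restrict x {}))"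
    unfolding traj_def by (subst IT.distr_lim) (auto intro: IT.PF.prob_space_P)
  moreover have "(\<lambda>x. restrict x {})
      \<in> measurable (traj P \<pi> \<nu>) (PiM {} (\<lambda>_. count_space UNIV))"
    unfolding traj_def by (simp add: measurable_cong_sets[OF IT.PF.sets_lim refl])
  ultimately show ?thesis
    by (rule prob_space_distrD[rotated])
qed

definition disc_cost :: "('s \<Rightarrow> 'a \<Rightarrow> real) \<Rightarrow> real \<Rightarrow> (nat \<Rightarrow> 's \<times> 'a) \<Rightarrow> real" where
  "disc_cost c \<gamma> \<omega> = (\<Sum>t. \<gamma> ^ t * c (fst (\<omega> t)) (snd (\<omega> t)))"

definition V_val ::
    "('s::finite \<Rightarrow> 'a::finite \<Rightarrow> real) \<Rightarrow> real \<Rightarrow> ('s, 'a) kernel \<Rightarrow> ('s, 'a) policy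
      \<Rightarrow> 's \<Rightarrow> real" where
  "V_val c \<gamma> P \<pi> s = (LINT \<omega>|traj P \<pi> (act \<pi> s). disc_cost c \<gamma> \<omega>)"

definition Q_val ::
    "('s::finite \<Rightarrow> 'a::finite \<Rightarrow> real) \<Rightarrow> real \<Rightarrow> ('s, 'a) kernel \<Rightarrow> ('s, 'a) policy
      \<Rightarrow> 's \<Rightarrow> 'a \<Rightarrow> real" where
  "Q_val c \<gamma> P \<pi> s a = (LINT \<omega>|traj P \<pi> (return_pmf (s, a)). disc_cost c \<gamma> \<omega>)"

text \<open>The suprema over \<open>U\<close> are maxima, as \<open>U\<close> is compact and the values are continuous in \<open>u\<close>.\<close>

definition V_rob ::
    "('s::finite \<Rightarrow> 'a::finite \<Rightarrow> real) \<Rightarrow> real \<Rightarrow> ('s, 'a) kernel \<Rightarrow> ('s, 'a) kernel set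
      \<Rightarrow> ('s, 'a) policy \<Rightarrow> 's \<Rightarrow> real" where
  "V_rob c \<gamma> PN U \<pi> s = (SUP u\<in>U. V_val c \<gamma> (PN + u) \<pi> s)"

definition Q_rob ::
    "('s::finite \<Rightarrow> 'a::finite \<Rightarrow> real) \<Rightarrow> real \<Rightarrow> ('s, 'a) kernel \<Rightarrow> ('s, 'a) kernel set
      \<Rightarrow> ('s, 'a) policy \<Rightarrow> real^'a^'s" where
  "Q_rob c \<gamma> PN U \<pi> = (\<chi> s a. SUP u\<in>U. Q_val c \<gamma> (PN + u) \<pi> s a)"

definition f_obj ::
    "('s::finite \<Rightarrow> 'a::finite \<Rightarrow> real) \<Rightarrow> real \<Rightarrow> ('s, 'a) kernel \<Rightarrow> ('s, 'a) kernel set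
      \<Rightarrow> real^'s \<Rightarrow> ('s, 'a) policy \<Rightarrow> real" where
  "f_obj c \<gamma> PN U \<rho> \<pi> = (\<Sum>s\<in>UNIV. \<rho> $ s * V_rob c \<gamma> PN U \<pi> s)"

definition optimal_robust ::
    "('s::finite \<Rightarrow> 'a::finite \<Rightarrow> real) \<Rightarrow> real \<Rightarrow> ('s, 'a) kernel \<Rightarrow> ('s, 'a) kernel set
      \<Rightarrow> ('s, 'a) policy \<Rightarrow> bool" where
  "optimal_robust c \<gamma> PN U \<pi>opt \<longleftrightarrow> \<pi>opt \<in> policies \<and>
     (\<forall>\<pi>\<in>policies. \<forall>s. V_rob c \<gamma> PN U \<pi>opt s \<le> V_rob c \<gamma> PN U \<pi> s)"

definition visit ::
    "real \<Rightarrow> ('s::finite, 'a::finite) kernel \<Rightarrow> ('s, 'a) policy \<Rightarrow> 's \<Rightarrow> 's \<Rightarrow> real" where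
  "visit \<gamma> P \<pi> s s' =
     (1 - \<gamma>) * (\<Sum>t. \<gamma> ^ t * \<P>(\<omega> in traj P \<pi> (act \<pi> s). fst (\<omega> t) = s'))"

definition visit_from ::
    "real \<Rightarrow> ('s::finite, 'a::finite) kernel \<Rightarrow> ('s, 'a) policy \<Rightarrow> real^'s \<Rightarrow> 's \<Rightarrow> real" where
  "visit_from \<gamma> P \<pi> \<rho> s' = (\<Sum>s\<in>UNIV. \<rho> $ s * visit \<gamma> P \<pi> s s')"

text \<open>
  The ratio is taken in \<^typ>\<open>ennreal\<close>, where \<open>x / 0 = \<infinity>\<close> for \<open>x > 0\<close> and \<open>0 / 0 = 0\<close>.
\<close>

definition mismatch ::
    "real \<Rightarrow> ('s::finite, 'a::finite) kernel \<Rightarrow> ('s, 'a) kernel set \<Rightarrow> ('s, 'a) policy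
      \<Rightarrow> real^'s \<Rightarrow> ennreal" where
  "mismatch \<gamma> PN U \<pi> \<rho> =
     (SUP u\<in>U. SUP s. ennreal (visit_from \<gamma> (PN + u) \<pi> \<rho> s) / ennreal (\<rho> $ s))"

text \<open>
  \<open>est k \<pi> x\<close> is the estimate of the robust Q-function of \<open>\<pi>\<close> formed at iteration \<open>k\<close> from the
  sample \<open>x\<close>.  As \<open>prob_simplex\<close> is compact and convex and the objective is strictly convex,
  the minimizer is unique.
\<close>

definition srpmd ::
    "(nat \<Rightarrow> real) \<Rightarrow> (nat \<Rightarrow> ('s::finite, 'a::finite) policy \<Rightarrow> 'x \<Rightarrow> real^'a^'s)
      \<Rightarrow> ('s, 'a) policy \<Rightarrow> (nat \<Rightarrow> 'x) \<Rightarrow> (nat \<Rightarrow> ('s, 'a) policy) \<Rightarrow> bool" where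
  "srpmd \<eta> est \<pi>0 x \<pi> \<longleftrightarrow> \<pi> 0 = \<pi>0 \<and>
     (\<forall>k s. is_arg_min
        (\<lambda>p. \<eta> k * (est k (\<pi> k) (x k) $ s \<bullet> p) + (norm (p - \<pi> k $ s))\<^sup>2)
        (\<lambda>p. p \<in> prob_simplex) (\<pi> (Suc k) $ s))"

text \<open>The sigma-algebra generated by the samples \<open>\<xi> 0, \<dots>, \<xi> (k - 1)\<close>.\<close>

definition past ::
    "'w measure \<Rightarrow> (nat \<Rightarrow> 'x measure) \<Rightarrow> (nat \<Rightarrow> 'w \<Rightarrow> 'x) \<Rightarrow> nat \<Rightarrow> 'w measure" where
  "past W X \<xi> k =
     vimage_algebra (space W) (\<lambda>\<omega>. \<lambda>i\<in>{..<k}. \<xi> i \<omega>) (PiM {..<k} X)"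

text \<open>
  \<open>est_error c \<gamma> PN U W X \<xi> est \<pi> k\<close> is the conditional expectation of the sup-norm error of the
  \<open>k\<close>-th estimate given the past.  It is \<^typ>\<open>ennreal\<close>-valued, so that a finite bound on it
  entails integrability of the error.
\<close>

definition est_error ::
    "('s::finite \<Rightarrow> 'a::finite \<Rightarrow> real) \<Rightarrow> real \<Rightarrow> ('s, 'a) kernel \<Rightarrow> ('s, 'a) kernel set
      \<Rightarrow> 'w measure \<Rightarrow> (nat \<Rightarrow> 'x measure) \<Rightarrow> (nat \<Rightarrow> 'w \<Rightarrow> 'x)
      \<Rightarrow> (nat \<Rightarrow> ('s, 'a) policy \<Rightarrow> 'x \<Rightarrow> real^'a^'s) \<Rightarrow> (nat \<Rightarrow> 'w \<Rightarrow> ('s, 'a) policy)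
      \<Rightarrow> nat \<Rightarrow> 'w \<Rightarrow> ennreal" where
  "est_error c \<gamma> PN U W X \<xi> est \<pi> k =
     nn_cond_exp W (past W X \<xi> k)
       (\<lambda>\<omega>. ennreal (infnorm (est k (\<pi> k \<omega>) (\<xi> k \<omega>) - Q_rob c \<gamma> PN U (\<pi> k \<omega>))))"

end

theory Submission
  imports Defs
begin

text \<open>
  By rectangularity a single kernel attains the robust value of a policy \<open>\<pi>\<close> in all states, so the
  performance difference lemma bounds \<open>V \<pi>' - V \<pi>\<close> from above and the gap \<open>V \<pi> - V \<pi>opt\<close> in
  terms of the robust advantages \<open>Q \<pi> \<bullet> (\<pi>' - \<pi>)\<close> and \<open>Q \<pi> \<bullet> (\<pi> - \<pi>opt)\<close>.  A proximal step
  with estimation error \<open>\<delta>\<close> satisfies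
  \<open>2 / \<eta> * \<parallel>\<pi>' - \<pi>\<parallel>\<^sup>2 \<le> V \<pi> - V \<pi>' + 2 * \<delta> / (1 - \<gamma>)\<close> in every state.  The weights in the bound
  for the gap depend on the worst kernel of the current iterate, so the distances to \<open>\<pi>opt\<close> do not
  telescope; instead their increments are bounded by the step lengths, whose squares sum to
  \<open>O(\<eta>)\<close> by the previous inequality, and Cauchy-Schwarz gives the \<open>1 / sqrt k\<close> term.
\<close>

section \<open>Marginals of the trajectory measure\<close>

text \<open>With noisy estimates neither the values nor the advantages have a definite sign along
  the iterates. The correction \<open>2 * \<delta> / (1 - \<gamma>)\<close> restores nonnegativity
  of the decrease in every state, and only then may visitation weights be replaced by
  \<open>M * \<rho>\<close>, after which the values telescope. The step lengths are instead averaged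
  with weights of total mass one, so \<open>M\<close> does not enter the square root. The proximal
  argument covers the iterates 0 to k - 1, while the index is drawn from 1 to k; the shift costs
  \<open>f (\<pi> 0) - f (\<pi> k)\<close>, which is absorbed because
  \<open>M / (1 - \<gamma>)\<close> is at least one. The pathwise constants are \<open>2 * M\<close>
  and \<open>4 * CARD('s)\<close>; the larger stated ones follow by relaxation. Two points are
  probabilistic. The pathwise bound contains a root of the random total error, of which only the
  mean is controlled. Moreover the iterates are given by a minimality condition in each outcome;
  their measurability comes from writing minimisers as projections and from Lipschitz continuity of
  the robust values.\<close>

primrec law :: "('s::finite, 'a::finite) kernel \<Rightarrow> ('s, 'a) policy \<Rightarrow> ('s \<times> 'a) pmf \<Rightarrow> nat
    \<Rightarrow> ('s \<times> 'a) pmf" where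
  "law P \<pi> \<nu> 0 = \<nu>"
| "law P \<pi> \<nu> (Suc t) = bind_pmf (law P \<pi> \<nu> t) (step P \<pi>)"

lemma distr_traj_component:
  "distr (traj P \<pi> \<nu>) (count_space UNIV) (\<lambda>\<omega>. \<omega> t) = measure_pmf (law P \<pi> \<nu> t)"
proof -
  let ?M = "\<lambda>_::nat. count_space (UNIV :: ('a \<times> 'b) set)"
  interpret IT: Ionescu_Tulcea "traj_kernel P \<pi> \<nu>" ?M
    by (rule Ionescu_Tulcea_traj_kernel)
  \<comment> \<open>The empty product has a single point, the function that is
    \<open>undefined\<close> everywhere; the construction starts from it.\<close>
  let ?x = "\<lambda>_::nat. undefined :: 'a \<times> 'b"
  have x: "?x \<in> space (PiM {0..<0} ?M)"
    by (simp add: space_PiM)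
  \<comment> \<open>Extending a history by one coordinate and projecting to that coordinate leaves
    only the one-step kernel, averaged over the history.\<close>
  have step: "distr (IT.C 0 (Suc t) ?x) (count_space UNIV) (\<lambda>\<omega>. \<omega> t)
      = IT.C 0 t ?x \<bind> traj_kernel P \<pi> \<nu> t" for t
  proof -
    have ne: "space (IT.C 0 t ?x) \<noteq> {}"
      using IT.prob_space_C[OF x, of t] by (rule prob_space.not_empty)
    have "distr (IT.C 0 t ?x \<bind> IT.eP t) (count_space UNIV) (\<lambda>\<omega>. \<omega> t)
        = IT.C 0 t ?x \<bind> (\<lambda>y. distr (IT.eP t y) (count_space UNIV) (\<lambda>\<omega>. \<omega> t))"
      using IT.measurable_eP[of t] ne
      by (intro distr_bind[where K="PiM {0..<Suc t} ?M"])
        (auto simp: measurable_cong_sets[OF IT.sets_C[OF x] refl])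
    also have "\<dots> = IT.C 0 t ?x \<bind> traj_kernel P \<pi> \<nu> t"
    proof (intro bind_cong refl)
      fix y assume "y \<in> space (IT.C 0 t ?x)"
      then have y: "y \<in> space (PiM {0..<t} ?M)"
        by (simp add: IT.space_C[OF x])
      have "distr (IT.eP t y) (count_space UNIV) (\<lambda>\<omega>. \<omega> t)
          = distr (traj_kernel P \<pi> \<nu> t y) (count_space UNIV) (\<lambda>z. z)"
        unfolding IT.eP_def
        apply (subst distr_distr)
        subgoal by (auto intro!: measurable_component_singleton)
        subgoal using y by (intro measurable_fun_upd[where J="{0..<t}"])
            (auto simp: traj_kernel_def)
        subgoal by (simp add: comp_def)
        done
      also have "\<dots> = traj_kernel P \<pi> \<nu> t y"
        by (intro distr_id2) (simp add: traj_kernel_def)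
      finally show "distr (IT.eP t y) (count_space UNIV) (\<lambda>\<omega>. \<omega> t) = traj_kernel P \<pi> \<nu> t y" .
    qed
    finally show ?thesis by simp
  qed
  have marg: "distr (IT.C 0 (Suc t) ?x) (count_space UNIV) (\<lambda>\<omega>. \<omega> t) = measure_pmf (law P \<pi> \<nu> t)"
    for t
  proof (induction t)
    case 0
    have "IT.C 0 0 ?x \<bind> traj_kernel P \<pi> \<nu> 0 = traj_kernel P \<pi> \<nu> 0 ?x"
      using x IT.P[of 0] by (auto intro!: bind_return)
    then show ?case
      unfolding step by (simp add: traj_kernel_def)
  next
    case (Suc t)
    \<comment> \<open>The kernel at time \<open>Suc t\<close> reads only coordinate
      \<open>t\<close>, so the average depends on the history only through the marginal in the
      induction hypothesis.\<close>
    have "IT.C 0 (Suc t) ?x \<bind> traj_kernel P \<pi> \<nu> (Suc t)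
        = IT.C 0 (Suc t) ?x \<bind> (\<lambda>\<omega>. measure_pmf (step P \<pi> (\<omega> t)))"
      by (simp add: traj_kernel_def[abs_def])
    also have "\<dots> = distr (IT.C 0 (Suc t) ?x) (count_space UNIV) (\<lambda>\<omega>. \<omega> t)
        \<bind> (\<lambda>z. measure_pmf (step P \<pi> z))"
    proof (rule bind_distr[where K="count_space UNIV", symmetric])
      show "(\<lambda>\<omega>. \<omega> t) \<in> measurable (IT.C 0 (Suc t) ?x) (count_space UNIV)"
        unfolding measurable_cong_sets[OF IT.sets_C[OF x] refl]
        by (auto intro!: measurable_component_singleton)
      show "space (IT.C 0 (Suc t) ?x) \<noteq> {}"
        using IT.prob_space_C[OF x] by (rule prob_space.not_empty)
    qed (simp add: measure_pmf_in_subprob_algebra)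
    also have "\<dots> = measure_pmf (law P \<pi> \<nu> (Suc t))"
      unfolding Suc by (simp add: measure_pmf_bind)
    finally show ?case
      using step[of "Suc t"] by simp
  qed
  let ?J = "{0..<Suc t}"
  have "distr (traj P \<pi> \<nu>) (count_space UNIV) (\<lambda>\<omega>. \<omega> t)
     = distr (distr (traj P \<pi> \<nu>) (PiM ?J ?M) (\<lambda>x. restrict x ?J)) (count_space UNIV) (\<lambda>\<omega>. \<omega> t)"
    by (subst distr_distr)
      (auto intro!: measurable_component_singleton measurable_restrict
        simp: comp_def traj_def measurable_cong_sets[OF IT.PF.sets_lim refl])
  also have "distr (traj P \<pi> \<nu>) (PiM ?J ?M) (\<lambda>x. restrict x ?J) = IT.CI ?J"
    unfolding traj_def by (rule IT.distr_lim) auto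
  also have "\<dots> = IT.C 0 (Suc t) ?x"
  proof -
    \<comment> \<open>For an initial segment the horizon chosen by \<open>CI\<close> is exactly
      \<open>Suc t\<close>, so restricting to the segment changes nothing.\<close>
    have "IT.up_to ?J = Suc t"
      using IT.up_to_iff_Ico[of ?J "Suc t"] IT.up_to_less[of ?J t] by simp
    then show ?thesis
      unfolding IT.CI_def by (simp only:) (subst IT.distr_C[OF order_refl x, symmetric, simplified], simp)
  qed
  finally show ?thesis
    by (simp only: marg)
qed

lemma measurable_traj_component: "(\<lambda>\<omega>. \<omega> t) \<in> measurable (traj P \<pi> \<nu>) (count_space UNIV)"
proof -
  interpret IT: Ionescu_Tulcea "traj_kernel P \<pi> \<nu>" "\<lambda>_. count_space UNIV"
    by (rule Ionescu_Tulcea_traj_kernel)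
  show ?thesis
    unfolding traj_def measurable_cong_sets[OF IT.PF.sets_lim refl]
    by (intro measurable_component_singleton) auto
qed

section \<open>Evaluation of a policy under a fixed kernel\<close>

lemma prob_simplexD:
  assumes "p \<in> prob_simplex"
  shows prob_simplex_nonneg: "0 \<le> p $ i" and prob_simplex_sum: "(\<Sum>i\<in>UNIV. p $ i) = 1"
  using assms by (auto simp: prob_simplex_def)

lemma pmf_vec_pmf:
  assumes "p \<in> prob_simplex"
  shows "pmf (vec_pmf p) i = p $ i"
  unfolding vec_pmf_def using prob_simplexD[OF assms]
  by (intro pmf_embed_pmf) (auto simp: nn_integral_count_space_finite)

lemma expectation_finite:
  fixes f :: "'b::finite \<Rightarrow> real"
  shows "measure_pmf.expectation p f = (\<Sum>x\<in>UNIV. pmf p x * f x)"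
  by (subst integral_measure_pmf[of UNIV]) auto

lemma sum_pmf_UNIV: "(\<Sum>x\<in>UNIV. pmf p (x :: 'b::finite)) = 1"
  using expectation_finite[of p "\<lambda>_. 1"] by simp

lemma expectation_bind_finite:
  fixes f :: "'b::finite \<Rightarrow> real" and p :: "'c::finite pmf"
  shows "measure_pmf.expectation (bind_pmf p g) f
     = (\<Sum>x\<in>UNIV. pmf p x * measure_pmf.expectation (g x) f)"
  by (subst pmf_expectation_bind[of UNIV]) auto

lemma expectation_act:
  fixes h :: "'s::finite \<times> 'a::finite \<Rightarrow> real"
  assumes "\<pi> \<in> policies"
  shows "measure_pmf.expectation (act \<pi> s) h = (\<Sum>a\<in>UNIV. \<pi> $ s $ a * h (s, a))"
proof -
  have "measure_pmf.expectation (act \<pi> s) h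
      = measure_pmf.expectation (vec_pmf (\<pi> $ s)) (\<lambda>a. h (s, a))"
    by (simp add: act_def)
  with assms show ?thesis
    by (simp add: expectation_finite pmf_vec_pmf policies_def)
qed

text \<open>Linearity in the initial law. Together with \<open>law_Suc_shift\<close> it permits
  conditioning on the first transition, whereas \<open>law\<close> itself unfolds the last
  one.\<close>

lemma law_bind:
  "law P \<pi> (bind_pmf \<sigma> g) t = bind_pmf \<sigma> (\<lambda>x. law P \<pi> (g x) t)"
  by (induction t) (simp_all add: bind_assoc_pmf)

lemma law_Suc_shift: "law P \<pi> \<nu> (Suc t) = law P \<pi> (bind_pmf \<nu> (step P \<pi>)) t"
  by (induction t) simp_all

text \<open>Under a stationary policy each action is drawn afresh from the current state, so the
  states alone form a Markov chain; this is its law.\<close>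

primrec st_law :: "('s::finite, 'a::finite) kernel \<Rightarrow> ('s, 'a) policy \<Rightarrow> 's \<Rightarrow> nat \<Rightarrow> 's pmf" where
  "st_law P \<pi> s 0 = return_pmf s"
| "st_law P \<pi> s (Suc t) =
     bind_pmf (st_law P \<pi> s t) (\<lambda>s'. bind_pmf (act \<pi> s') (\<lambda>x. vec_pmf (P $ fst x $ snd x)))"

lemma law_act: "law P \<pi> (act \<pi> s) t = bind_pmf (st_law P \<pi> s t) (act \<pi>)"
  by (induction t) (simp_all add: bind_return_pmf bind_assoc_pmf step_def[abs_def])

lemma map_fst_act: "map_pmf fst (act \<pi> s) = return_pmf s"
  by (simp add: act_def pmf.map_comp comp_def map_pmf_const)

lemma map_fst_law_act: "map_pmf fst (law P \<pi> (act \<pi> s) t) = st_law P \<pi> s t"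
  by (simp add: law_act map_bind_pmf map_fst_act bind_return_pmf')

text \<open>The unnormalised visitation measure, of total mass \<open>1 / (1 - \<gamma>)\<close>; as
  a matrix it is the inverse of the identity minus \<gamma> times the transition matrix of the
  policy. Without the normalisation its diagonal is at least one.\<close>

definition occ :: "real \<Rightarrow> ('s::finite, 'a::finite) kernel \<Rightarrow> ('s, 'a) policy \<Rightarrow> 's \<Rightarrow> 's \<Rightarrow> real" where
  "occ \<gamma> P \<pi> s s' = (\<Sum>t. \<gamma> ^ t * pmf (st_law P \<pi> s t) s')"

section \<open>Occupation weights and Bellman equations for one kernel and one policy\<close>

locale mdp =
  fixes c :: "'s::finite \<Rightarrow> 'a::finite \<Rightarrow> real" and \<gamma> :: real
    and P :: "('s, 'a) kernel" and \<pi> :: "('s, 'a) policy"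
  assumes cost: "0 < c s a" "c s a \<le> 1"
    and discount: "0 < \<gamma>" "\<gamma> < 1"
    and kernel: "P \<in> kernels"
    and policy: "\<pi> \<in> policies"
begin

lemma P_nonneg: "0 \<le> P $ s $ a $ s'" and P_sum: "(\<Sum>s'\<in>UNIV. P $ s $ a $ s') = 1"
  using kernel by (auto simp: kernels_def prob_simplex_def)

lemma \<pi>_nonneg: "0 \<le> \<pi> $ s $ a" and \<pi>_sum: "(\<Sum>a\<in>UNIV. \<pi> $ s $ a) = 1"
  using policy by (auto simp: policies_def prob_simplex_def)

lemma summable_discounted:
  assumes "\<And>t. \<bar>x t\<bar> \<le> B"
  shows "summable (\<lambda>t. \<gamma> ^ t * x t)"
proof (rule summable_comparison_test')
  show "summable (\<lambda>t. \<gamma> ^ t * B)"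
    using discount by (intro summable_mult2 summable_geometric) auto
  show "norm (\<gamma> ^ t * x t) \<le> \<gamma> ^ t * B" if "t \<ge> 0" for t
    using assms[of t] discount by (auto simp: abs_mult intro!: mult_left_mono)
qed

lemma suminf_discount: "(\<Sum>t. \<gamma> ^ t) = 1 / (1 - \<gamma>)"
  using discount by (intro suminf_geometric) auto

text \<open>Costs are at most one, so a geometric series dominates and sum and integral may be
  exchanged. The value then depends only on one-time marginals.\<close>

lemma integral_disc_cost:
  "(LINT \<omega>|traj P \<pi> \<nu>. disc_cost c \<gamma> \<omega>)
     = (\<Sum>t. \<gamma> ^ t * measure_pmf.expectation (law P \<pi> \<nu> t) (\<lambda>x. c (fst x) (snd x)))"
proof -
  interpret T: prob_space "traj P \<pi> \<nu>"
    by (rule prob_space_traj)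
  note comp = measurable_traj_component
  have meas: "(\<lambda>\<omega>. \<gamma> ^ t * c (fst (\<omega> t)) (snd (\<omega> t))) \<in> borel_measurable (traj P \<pi> \<nu>)" for t
    using measurable_compose[OF comp[of t], of "\<lambda>x. \<gamma> ^ t * c (fst x) (snd x)" borel] by simp
  have bound: "norm (\<gamma> ^ t * c s a) \<le> \<gamma> ^ t" for t s a
    using cost[of s a] discount by (auto simp: abs_mult intro!: mult_left_le)
  have int: "integrable (traj P \<pi> \<nu>) (\<lambda>\<omega>. \<gamma> ^ t * c (fst (\<omega> t)) (snd (\<omega> t)))" for t
    by (rule T.integrable_const_bound[OF _ meas, where B="\<gamma> ^ t"]) (use bound in auto)
  have geo: "summable (\<lambda>t. \<gamma> ^ t)"
    using discount by (intro summable_geometric) auto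
  have "(LINT \<omega>|traj P \<pi> \<nu>. disc_cost c \<gamma> \<omega>)
      = (\<Sum>t. LINT \<omega>|traj P \<pi> \<nu>. \<gamma> ^ t * c (fst (\<omega> t)) (snd (\<omega> t)))"
    unfolding disc_cost_def
  proof (rule integral_suminf[OF int])
    show "AE \<omega> in traj P \<pi> \<nu>. summable (\<lambda>t. norm (\<gamma> ^ t * c (fst (\<omega> t)) (snd (\<omega> t))))"
      using bound by (intro AE_I2 summable_comparison_test'[OF geo]) auto
    have "(LINT \<omega>|traj P \<pi> \<nu>. norm (\<gamma> ^ t * c (fst (\<omega> t)) (snd (\<omega> t)))) \<le> \<gamma> ^ t" for t
      using bound[of t] integrable_norm[OF int[of t]]
      by (intro T.integral_le_const) auto
    then show "summable (\<lambda>t. LINT \<omega>|traj P \<pi> \<nu>. norm (\<gamma> ^ t * c (fst (\<omega> t)) (snd (\<omega> t))))"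
      by (intro summable_comparison_test'[OF geo]) (auto intro!: integral_nonneg)
  qed
  moreover have "(LINT \<omega>|traj P \<pi> \<nu>. \<gamma> ^ t * c (fst (\<omega> t)) (snd (\<omega> t)))
      = \<gamma> ^ t * measure_pmf.expectation (law P \<pi> \<nu> t) (\<lambda>x. c (fst x) (snd x))" for t
    unfolding distr_traj_component[symmetric]
    by (subst integral_distr[OF comp]) auto
  ultimately show ?thesis
    by (simp only:)
qed

lemma occ_summable: "summable (\<lambda>t. \<gamma> ^ t * pmf (st_law P \<pi> s t) s')"
  by (rule summable_discounted[where B=1]) (simp add: pmf_le_1)

lemma visit_eq: "visit \<gamma> P \<pi> s s' = (1 - \<gamma>) * occ \<gamma> P \<pi> s s'"
proof -
  have "\<P>(\<omega> in traj P \<pi> (act \<pi> s). fst (\<omega> t) = s') = pmf (st_law P \<pi> s t) s'" for t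
  proof -
    have "\<P>(\<omega> in traj P \<pi> (act \<pi> s). fst (\<omega> t) = s')
      = measure (distr (traj P \<pi> (act \<pi> s)) (count_space UNIV) (\<lambda>\<omega>. \<omega> t)) {x. fst x = s'}"
      by (subst measure_distr[OF measurable_traj_component]) (auto simp: vimage_def Int_def conj_commute)
    also have "\<dots> = measure (law P \<pi> (act \<pi> s) t) (fst -` {s'})"
      by (simp add: distr_traj_component vimage_def)
    also have "\<dots> = pmf (st_law P \<pi> s t) s'"
      by (simp add: map_fst_law_act[symmetric] pmf_map)
    finally show ?thesis .
  qed
  then show ?thesis
    by (simp add: visit_def occ_def)
qed

lemma occ_nonneg: "0 \<le> occ \<gamma> P \<pi> s s'"
  unfolding occ_def using discount by (intro suminf_nonneg occ_summable) auto

text \<open>The visit at time zero alone contributes one. This keeps the starting state when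
  nonpositive terms of other states are dropped.\<close>

lemma occ_diag: "1 \<le> occ \<gamma> P \<pi> s s"
proof -
  have "(\<Sum>t<1. \<gamma> ^ t * pmf (st_law P \<pi> s t) s) \<le> occ \<gamma> P \<pi> s s"
    unfolding occ_def using discount by (intro sum_le_suminf occ_summable) auto
  then show ?thesis by simp
qed

lemma occ_apply:
  "(\<Sum>s'\<in>UNIV. occ \<gamma> P \<pi> s s' * h s') = (\<Sum>t. \<gamma> ^ t * (\<Sum>s'\<in>UNIV. pmf (st_law P \<pi> s t) s' * h s'))"
proof -
  have "(\<Sum>s'\<in>UNIV. occ \<gamma> P \<pi> s s' * h s')
      = (\<Sum>s'\<in>UNIV. \<Sum>t. \<gamma> ^ t * pmf (st_law P \<pi> s t) s' * h s')"
    unfolding occ_def by (intro sum.cong refl suminf_mult2 occ_summable)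
  also have "\<dots> = (\<Sum>t. \<Sum>s'\<in>UNIV. \<gamma> ^ t * pmf (st_law P \<pi> s t) s' * h s')"
    by (intro suminf_sum[symmetric] summable_mult2 occ_summable)
  finally show ?thesis
    by (simp add: sum_distrib_left mult.assoc)
qed

lemma occ_sum: "(\<Sum>s'\<in>UNIV. occ \<gamma> P \<pi> s s') = 1 / (1 - \<gamma>)"
  using occ_apply[of s "\<lambda>_. 1"] by (simp add: sum_pmf_UNIV suminf_discount)

definition trans_mat :: "real^'s^'s" where
  "trans_mat = (\<chi> s s'. \<Sum>a\<in>UNIV. \<pi> $ s $ a * P $ s $ a $ s')"

lemma pmf_st_law_Suc:
  "pmf (st_law P \<pi> s (Suc t)) s' = (\<Sum>x\<in>UNIV. pmf (st_law P \<pi> s t) x * trans_mat $ x $ s')"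
proof -
  have "pmf (bind_pmf (act \<pi> x) (\<lambda>y. vec_pmf (P $ fst y $ snd y))) s' = trans_mat $ x $ s'" for x
    using kernel by (simp add: pmf_bind expectation_act[OF policy] pmf_vec_pmf trans_mat_def kernels_def)
  then show ?thesis
    by (simp add: pmf_bind expectation_finite)
qed

text \<open>A visit either happens at time zero or follows a visit one step earlier. Splitting off
  the last transition puts \<open>trans_mat\<close> on the right, which leads to a left
  inverse.\<close>

lemma occ_eq:
  "occ \<gamma> P \<pi> s s' = (if s = s' then 1 else 0) + \<gamma> * (\<Sum>x\<in>UNIV. occ \<gamma> P \<pi> s x * trans_mat $ x $ s')"
proof -
  have "occ \<gamma> P \<pi> s s' = (if s = s' then 1 else 0) + (\<Sum>t. \<gamma> ^ Suc t * pmf (st_law P \<pi> s (Suc t)) s')"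
    unfolding occ_def using suminf_split_head[OF occ_summable, of s s'] by simp
  also have "(\<Sum>t. \<gamma> ^ Suc t * pmf (st_law P \<pi> s (Suc t)) s')
      = (\<Sum>t. \<gamma> * (\<gamma> ^ t * (\<Sum>x\<in>UNIV. pmf (st_law P \<pi> s t) x * trans_mat $ x $ s')))"
    by (simp add: pmf_st_law_Suc mult.assoc del: st_law.simps)
  also have "\<dots> = \<gamma> * (\<Sum>t. \<gamma> ^ t * (\<Sum>x\<in>UNIV. pmf (st_law P \<pi> s t) x * trans_mat $ x $ s'))"
  proof (rule suminf_mult)
    have "summable (\<lambda>t. \<Sum>x\<in>UNIV. (\<gamma> ^ t * pmf (st_law P \<pi> s t) x) * trans_mat $ x $ s')"
      by (intro summable_sum summable_mult2 occ_summable)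
    then show "summable (\<lambda>t. \<gamma> ^ t * (\<Sum>x\<in>UNIV. pmf (st_law P \<pi> s t) x * trans_mat $ x $ s'))"
      by (simp add: sum_distrib_left mult.assoc)
  qed
  finally show ?thesis
    by (simp add: occ_apply)
qed

text \<open>
  In finite dimension the left inverse of \<open>mat 1 - \<gamma> trans_mat\<close> is also a right inverse: the first
  gives the performance difference, the second the Bellman equation.
\<close>

definition occ_mat :: "real^'s^'s" where
  "occ_mat = (\<chi> s s'. occ \<gamma> P \<pi> s s')"

definition mean_cost :: "real^'s" where
  "mean_cost = (\<chi> s. \<Sum>a\<in>UNIV. \<pi> $ s $ a * c s a)"

lemma
  shows occ_mat_left: "occ_mat ** (mat 1 - \<gamma> *\<^sub>R trans_mat) = mat 1"
    and occ_mat_right: "(mat 1 - \<gamma> *\<^sub>R trans_mat) ** occ_mat = mat 1"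
proof -
  show "occ_mat ** (mat 1 - \<gamma> *\<^sub>R trans_mat) = mat 1"
  proof -
    have "(\<Sum>k\<in>UNIV. occ \<gamma> P \<pi> i k * (if k = j then 1 else 0)) = occ \<gamma> P \<pi> i j" for i j
      by (simp add: if_distrib cong: if_cong)
    moreover have "(\<Sum>k\<in>UNIV. occ \<gamma> P \<pi> i k * (\<gamma> * trans_mat $ k $ j))
        = \<gamma> * (\<Sum>k\<in>UNIV. occ \<gamma> P \<pi> i k * trans_mat $ k $ j)" for i j
      by (simp add: sum_distrib_left mult_ac)
    ultimately have "(occ_mat ** (mat 1 - \<gamma> *\<^sub>R trans_mat)) $ i $ j = mat 1 $ i $ j" for i j
      using occ_eq[of i j]
      by (simp add: matrix_matrix_mult_def occ_mat_def mat_def right_diff_distrib sum_subtractf)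
    then show ?thesis
      by (simp add: vec_eq_iff)
  qed
  then show "(mat 1 - \<gamma> *\<^sub>R trans_mat) ** occ_mat = mat 1"
    by (simp add: matrix_left_right_inverse)
qed

lemma V_val_occ: "V_val c \<gamma> P \<pi> s = (occ_mat *v mean_cost) $ s"
proof -
  have "V_val c \<gamma> P \<pi> s
      = (\<Sum>t. \<gamma> ^ t * (\<Sum>x\<in>UNIV. pmf (st_law P \<pi> s t) x * mean_cost $ x))"
    by (simp add: V_val_def integral_disc_cost law_act expectation_bind_finite
        expectation_act[OF policy] mean_cost_def)
  also have "\<dots> = (\<Sum>s'\<in>UNIV. occ \<gamma> P \<pi> s s' * mean_cost $ s')"
    by (rule occ_apply[symmetric])
  finally show ?thesis
    by (simp add: matrix_vector_mult_def occ_mat_def)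
qed

lemma trans_mat_apply:
  "(trans_mat *v h) $ s = (\<Sum>a\<in>UNIV. \<pi> $ s $ a * (\<Sum>s'\<in>UNIV. P $ s $ a $ s' * h $ s'))"
  by (simp add: matrix_vector_mult_def trans_mat_def sum_distrib_left sum_distrib_right mult.assoc)
    (rule sum.swap)

lemma backup_eq:
  "(\<Sum>a\<in>UNIV. \<pi> $ s $ a * (c s a + \<gamma> * (\<Sum>s'\<in>UNIV. P $ s $ a $ s' * h $ s')))
     = (mean_cost + \<gamma> *\<^sub>R (trans_mat *v h)) $ s"
  by (simp add: trans_mat_apply mean_cost_def distrib_left sum.distrib sum_distrib_left mult_ac)

text \<open>Both sides come from \<open>occ_mat\<close>: the value is its image of the mean cost,
  and any \<open>h\<close> is its image of \<open>h\<close> minus the discounted transition of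
  \<open>h\<close>, so subtraction leaves the Bellman residual of \<open>h\<close>. An arbitrary
  \<open>h\<close> is wanted because it will be a robust value, which need not be the value of this
  policy under this kernel.\<close>

lemma performance_difference:
  "V_val c \<gamma> P \<pi> s - h s
     = (\<Sum>s'\<in>UNIV. occ \<gamma> P \<pi> s s' *
         ((\<Sum>a\<in>UNIV. \<pi> $ s' $ a * (c s' a + \<gamma> * (\<Sum>x\<in>UNIV. P $ s' $ a $ x * h x))) - h s'))"
proof -
  define g where "g = (\<chi> s. h s)"
  have "g = occ_mat *v ((mat 1 - \<gamma> *\<^sub>R trans_mat) *v g)"
    by (simp add: matrix_vector_mul_assoc occ_mat_left)
  then have "(occ_mat *v mean_cost) - g
      = occ_mat *v (mean_cost + \<gamma> *\<^sub>R (trans_mat *v g) - g)"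
    by (simp add: matrix_vector_mult_diff_distrib matrix_vector_right_distrib
        matrix_vector_mult_diff_rdistrib scaleR_matrix_vector_assoc[symmetric] algebra_simps)
  then have "V_val c \<gamma> P \<pi> s - g $ s = (occ_mat *v (mean_cost + \<gamma> *\<^sub>R (trans_mat *v g) - g)) $ s"
    by (simp add: V_val_occ vec_eq_iff)
  also have "\<dots> = (\<Sum>s'\<in>UNIV. occ \<gamma> P \<pi> s s' * (
       (\<Sum>a\<in>UNIV. \<pi> $ s' $ a * (c s' a + \<gamma> * (\<Sum>x\<in>UNIV. P $ s' $ a $ x * g $ x))) - g $ s'))"
    unfolding backup_eq by (simp add: matrix_vector_mult_def occ_mat_def)
  finally show ?thesis
    by (simp add: g_def)
qed

text \<open>First-step analysis: after the first transition the process starts afresh from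
  \<open>act \<pi> s'\<close>, weighted by the kernel.\<close>

lemma Q_val_eq: "Q_val c \<gamma> P \<pi> s a = c s a + \<gamma> * (\<Sum>s'\<in>UNIV. P $ s $ a $ s' * V_val c \<gamma> P \<pi> s')"
proof -
  let ?E = "\<lambda>p. measure_pmf.expectation p (\<lambda>x. c (fst x) (snd x))"
  have E_le: "\<bar>?E p\<bar> \<le> 1" for p
  proof -
    have "?E p = (\<Sum>x\<in>UNIV. pmf p x * c (fst x) (snd x))"
      by (rule expectation_finite)
    moreover have "\<dots> \<le> (\<Sum>x\<in>UNIV. pmf p x)"
      using cost by (intro sum_mono mult_left_le) auto
    moreover have "0 \<le> (\<Sum>x\<in>UNIV. pmf p x * c (fst x) (snd x))"
      using cost by (intro sum_nonneg mult_nonneg_nonneg) (auto simp: less_imp_le)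
    ultimately show ?thesis
      by (simp add: sum_pmf_UNIV)
  qed
  have shift: "?E (law P \<pi> (return_pmf (s, a)) (Suc t))
      = (\<Sum>s'\<in>UNIV. P $ s $ a $ s' * ?E (law P \<pi> (act \<pi> s') t))" for t
    using kernel by (simp add: law_Suc_shift bind_return_pmf step_def law_bind
        expectation_bind_finite pmf_vec_pmf kernels_def del: law.simps)
  have sm: "summable (\<lambda>t. \<gamma> ^ t * ?E (law P \<pi> \<nu> t))" for \<nu>
    by (rule summable_discounted[OF E_le])
  have "Q_val c \<gamma> P \<pi> s a = c s a + (\<Sum>t. \<gamma> ^ Suc t * ?E (law P \<pi> (return_pmf (s, a)) (Suc t)))"
    unfolding Q_val_def integral_disc_cost
    using suminf_split_head[OF sm[of "return_pmf (s, a)"]] by simp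
  also have "(\<Sum>t. \<gamma> ^ Suc t * ?E (law P \<pi> (return_pmf (s, a)) (Suc t)))
     = (\<Sum>t. \<Sum>s'\<in>UNIV. \<gamma> * P $ s $ a $ s' * (\<gamma> ^ t * ?E (law P \<pi> (act \<pi> s') t)))"
    unfolding shift by (simp add: sum_distrib_left mult_ac)
  also have "\<dots> = (\<Sum>s'\<in>UNIV. \<Sum>t. \<gamma> * P $ s $ a $ s' * (\<gamma> ^ t * ?E (law P \<pi> (act \<pi> s') t)))"
    by (intro suminf_sum summable_mult sm)
  also have "\<dots> = (\<Sum>s'\<in>UNIV. \<gamma> * P $ s $ a $ s' * V_val c \<gamma> P \<pi> s')"
    unfolding V_val_def integral_disc_cost by (intro sum.cong refl suminf_mult sm)
  finally show ?thesis
    by (simp add: sum_distrib_left mult.assoc)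
qed

lemma V_val_Bellman: "V_val c \<gamma> P \<pi> s = (\<Sum>a\<in>UNIV. \<pi> $ s $ a * Q_val c \<gamma> P \<pi> s a)"
proof -
  let ?V = "occ_mat *v mean_cost"
  have "(mat 1 - \<gamma> *\<^sub>R trans_mat) *v ?V = mean_cost"
    by (simp add: matrix_vector_mul_assoc occ_mat_right)
  then have "?V = mean_cost + \<gamma> *\<^sub>R (trans_mat *v ?V)"
    by (simp add: matrix_vector_mult_diff_rdistrib scaleR_matrix_vector_assoc[symmetric] algebra_simps)
  then have "?V $ s = (\<Sum>a\<in>UNIV. \<pi> $ s $ a * (c s a + \<gamma> * (\<Sum>s'\<in>UNIV. P $ s $ a $ s' * ?V $ s')))"
    unfolding backup_eq by simp
  then show ?thesis
    by (simp add: Q_val_eq V_val_occ)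
qed

lemma V_val_bounds: "0 \<le> V_val c \<gamma> P \<pi> s" "V_val c \<gamma> P \<pi> s \<le> 1 / (1 - \<gamma>)"
proof -
  have V: "V_val c \<gamma> P \<pi> s = (\<Sum>s'\<in>UNIV. occ \<gamma> P \<pi> s s' * mean_cost $ s')"
    by (simp add: V_val_occ matrix_vector_mult_def occ_mat_def)
  have m: "0 \<le> mean_cost $ x" "mean_cost $ x \<le> 1" for x
  proof -
    show "0 \<le> mean_cost $ x"
      unfolding mean_cost_def using \<pi>_nonneg cost by (auto intro!: sum_nonneg simp: less_imp_le)
    have "mean_cost $ x \<le> (\<Sum>a\<in>UNIV. \<pi> $ x $ a)"
      unfolding mean_cost_def using \<pi>_nonneg cost by (auto intro!: sum_mono mult_left_le)
    then show "mean_cost $ x \<le> 1"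
      by (simp add: \<pi>_sum)
  qed
  show "0 \<le> V_val c \<gamma> P \<pi> s"
    unfolding V using occ_nonneg m by (auto intro!: sum_nonneg)
  have "V_val c \<gamma> P \<pi> s \<le> (\<Sum>s'\<in>UNIV. occ \<gamma> P \<pi> s s')"
    unfolding V using occ_nonneg m by (auto intro!: sum_mono mult_left_le)
  then show "V_val c \<gamma> P \<pi> s \<le> 1 / (1 - \<gamma>)"
    by (simp add: occ_sum)
qed

end

section \<open>Robust values\<close>

lemma abs_component_le_infnorm:
  fixes x :: "real^'a^'s"
  shows "\<bar>x $ s $ a\<bar> \<le> infnorm x"
proof -
  have "axis s (axis a 1) \<in> (Basis :: (real^'a^'s) set)"
    by (simp add: axis_in_Basis_iff)
  from Basis_le_infnorm[OF this, of x] show ?thesis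
    by (simp add: inner_axis)
qed

context robust_mdp
begin

abbreviation V :: "('s, 'a) policy \<Rightarrow> 's \<Rightarrow> real" where
  "V \<equiv> V_rob c \<gamma> PN U"

abbreviation Q :: "('s, 'a) policy \<Rightarrow> real^'a^'s" where
  "Q \<equiv> Q_rob c \<gamma> PN U"

lemma mdp_nominal:
  assumes "u \<in> U" "\<pi> \<in> policies"
  shows "mdp c \<gamma> (PN + u) \<pi>"
  using assms cost discount U_kernels by unfold_locales auto

lemma V_val_le_V:
  assumes "u \<in> U" "\<pi> \<in> policies"
  shows "V_val c \<gamma> (PN + u) \<pi> s \<le> V \<pi> s"
  unfolding V_rob_def
proof (rule cSUP_upper[OF assms(1)])
  show "bdd_above ((\<lambda>u. V_val c \<gamma> (PN + u) \<pi> s) ` U)"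
    using mdp.V_val_bounds(2)[OF mdp_nominal] assms(2) by (intro bdd_aboveI2) auto
qed

lemma V_leI:
  assumes "\<And>u. u \<in> U \<Longrightarrow> V_val c \<gamma> (PN + u) \<pi> s \<le> B"
  shows "V \<pi> s \<le> B"
  unfolding V_rob_def using U_nonempty assms by (intro cSUP_least) auto

lemma expected_mono:
  assumes "u \<in> U" "\<And>x. g x \<le> h x"
  shows "(\<Sum>x\<in>UNIV. (PN + u) $ s $ a $ x * g x) \<le> (\<Sum>x\<in>UNIV. (PN + u) $ s $ a $ x * h x)"
proof -
  have "0 \<le> (PN + u) $ s $ a $ x" for x
    using U_kernels[OF assms(1)] unfolding kernels_def prob_simplex_def by blast
  with assms show ?thesis
    by (intro sum_mono mult_left_mono) auto
qed

text \<open>The last clause also covers actions that \<open>\<pi>\<close> never takes, so it is more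
  than attaining the value. It makes \<open>Q \<pi>\<close> an upper bound for the backup of
  \<open>V \<pi>\<close> under every kernel of the uncertainty set, including those that are worst
  for another policy.\<close>

definition worst_case :: "('s, 'a) policy \<Rightarrow> ('s, 'a) kernel \<Rightarrow> bool" where
  "worst_case \<pi> u \<longleftrightarrow> u \<in> U \<and> (\<forall>s. V \<pi> s = V_val c \<gamma> (PN + u) \<pi> s)
     \<and> (\<forall>s a. Q \<pi> $ s $ a = c s a + \<gamma> * (\<Sum>x\<in>UNIV. (PN + u) $ s $ a $ x * V \<pi> x))
     \<and> (\<forall>s a. \<forall>v\<in>U. (\<Sum>x\<in>UNIV. (PN + v) $ s $ a $ x * V \<pi> x)
          \<le> (\<Sum>x\<in>UNIV. (PN + u) $ s $ a $ x * V \<pi> x))"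

lemma worst_caseD:
  assumes "worst_case \<pi> u"
  shows "u \<in> U" "V \<pi> s = V_val c \<gamma> (PN + u) \<pi> s"
    "Q \<pi> $ s $ a = c s a + \<gamma> * (\<Sum>x\<in>UNIV. (PN + u) $ s $ a $ x * V \<pi> x)"
    "v \<in> U \<Longrightarrow> (\<Sum>x\<in>UNIV. (PN + v) $ s $ a $ x * V \<pi> x)
        \<le> (\<Sum>x\<in>UNIV. (PN + u) $ s $ a $ x * V \<pi> x)"
  using assms unfolding worst_case_def by blast+

text \<open>
  Rectangularity lets one element of \<open>U\<close> maximise the expected robust value in every
  state-action pair at once; one step of policy evaluation with it does not decrease \<open>V \<pi>\<close>, so
  by monotonicity its value is \<open>V \<pi>\<close>.
\<close>

lemma worst_case_exists:
  assumes \<pi>: "\<pi> \<in> policies"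
  obtains u where "worst_case \<pi> u"
proof -
  let ?e = "\<lambda>v s a. \<Sum>x\<in>UNIV. (PN + v) $ s $ a $ x * V \<pi> x"
  have ex: "\<exists>w\<in>U. \<forall>v\<in>U. ?e v s a \<le> ?e w s a" for s a
    by (rule continuous_attains_sup[OF U_compact U_nonempty])
      (auto intro!: continuous_intros)
  define w where "w s a = (SOME w. w \<in> U \<and> (\<forall>v\<in>U. ?e v s a \<le> ?e w s a))" for s a
  have w: "w s a \<in> U" "v \<in> U \<Longrightarrow> ?e v s a \<le> ?e (w s a) s a" for s a v
    using someI_ex[of "\<lambda>w. w \<in> U \<and> (\<forall>v\<in>U. ?e v s a \<le> ?e w s a)"] ex[of s a]
    unfolding w_def by blast+
  define u where "u = (\<chi> s a. w s a $ s $ a)"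
  have "u \<in> {u. \<forall>s a. u $ s $ a \<in> (\<lambda>v. v $ s $ a) ` U}"
    using w(1) by (auto simp: u_def)
  with U_rectangular[unfolded rectangular_def] have u: "u \<in> U"
    by (rule ssubst[where P="\<lambda>S. u \<in> S"])
  have max: "?e v s a \<le> ?e u s a" if "v \<in> U" for v s a
    using w(2)[OF that, of s a] by (simp add: u_def)
  interpret u: mdp c \<gamma> "PN + u" \<pi>
    using u \<pi> by (rule mdp_nominal)
  have le: "V \<pi> s \<le> (\<Sum>a\<in>UNIV. \<pi> $ s $ a * (c s a + \<gamma> * ?e u s a))" for s
  proof (rule V_leI)
    fix v assume v: "v \<in> U"
    interpret v: mdp c \<gamma> "PN + v" \<pi>
      using v \<pi> by (rule mdp_nominal)
    have "(\<Sum>x\<in>UNIV. (PN + v) $ s $ a $ x * V_val c \<gamma> (PN + v) \<pi> x) \<le> ?e u s a" for a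
      by (rule order_trans[OF expected_mono[OF v V_val_le_V[OF v \<pi>]] max[OF v]])
    then have "\<pi> $ s $ a * Q_val c \<gamma> (PN + v) \<pi> s a \<le> \<pi> $ s $ a * (c s a + \<gamma> * ?e u s a)" for a
      unfolding v.Q_val_eq using discount by (intro mult_left_mono add_left_mono u.\<pi>_nonneg) auto
    then show "V_val c \<gamma> (PN + v) \<pi> s \<le> (\<Sum>a\<in>UNIV. \<pi> $ s $ a * (c s a + \<gamma> * ?e u s a))"
      unfolding v.V_val_Bellman[of s] by (rule sum_mono)
  qed
  have V: "V \<pi> s = V_val c \<gamma> (PN + u) \<pi> s" for s
  proof (rule antisym)
    have "0 \<le> V_val c \<gamma> (PN + u) \<pi> s - V \<pi> s"
      unfolding u.performance_difference using le
      by (intro sum_nonneg mult_nonneg_nonneg u.occ_nonneg) auto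
    then show "V \<pi> s \<le> V_val c \<gamma> (PN + u) \<pi> s" by simp
  qed (rule V_val_le_V[OF u \<pi>])
  have Q: "Q \<pi> $ s $ a = c s a + \<gamma> * ?e u s a" for s a
  proof -
    have "(SUP v\<in>U. Q_val c \<gamma> (PN + v) \<pi> s a) = c s a + \<gamma> * ?e u s a"
    proof (rule cSup_eq_maximum)
      show "c s a + \<gamma> * ?e u s a \<in> (\<lambda>v. Q_val c \<gamma> (PN + v) \<pi> s a) ` U"
        using u by (auto simp: u.Q_val_eq V intro!: image_eqI[of _ _ u])
      fix y assume "y \<in> (\<lambda>v. Q_val c \<gamma> (PN + v) \<pi> s a) ` U"
      then obtain v where v: "v \<in> U" "y = Q_val c \<gamma> (PN + v) \<pi> s a" by auto
      interpret v: mdp c \<gamma> "PN + v" \<pi>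
        using v(1) \<pi> by (rule mdp_nominal)
      have "(\<Sum>x\<in>UNIV. (PN + v) $ s $ a $ x * V_val c \<gamma> (PN + v) \<pi> x) \<le> ?e u s a"
        by (rule order_trans[OF expected_mono[OF v(1) V_val_le_V[OF v(1) \<pi>]] max[OF v(1)]])
      then show "y \<le> c s a + \<gamma> * ?e u s a"
        using discount by (simp add: v(2) v.Q_val_eq)
    qed
    then show ?thesis by (simp add: Q_rob_def)
  qed
  show ?thesis
    using that[of u] u V Q max unfolding worst_case_def by blast
qed

lemma Q_ge:
  assumes "\<pi> \<in> policies" "v \<in> U"
  shows "c s a + \<gamma> * (\<Sum>x\<in>UNIV. (PN + v) $ s $ a $ x * V \<pi> x) \<le> Q \<pi> $ s $ a"
proof -
  obtain u where wc: "worst_case \<pi> u"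
    using worst_case_exists[OF assms(1)] .
  from worst_caseD(4)[OF wc assms(2), of s a] show ?thesis
    unfolding worst_caseD(3)[OF wc] using discount by simp
qed

lemma V_eq_Q:
  assumes "\<pi> \<in> policies"
  shows "V \<pi> s = Q \<pi> $ s \<bullet> \<pi> $ s"
proof -
  obtain u where wc: "worst_case \<pi> u"
    using worst_case_exists[OF assms] .
  note u = worst_caseD(1-3)[OF wc]
  interpret mdp c \<gamma> "PN + u" \<pi>
    using u(1) assms by (rule mdp_nominal)
  show ?thesis
    using V_val_Bellman[of s] by (simp add: u(2) u(3) Q_val_eq inner_vec_def mult.commute)
qed

lemma V_bounds:
  assumes "\<pi> \<in> policies"
  shows "0 \<le> V \<pi> s" "V \<pi> s \<le> 1 / (1 - \<gamma>)"
proof -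
  obtain u where wc: "worst_case \<pi> u"
    using worst_case_exists[OF assms] .
  note u = worst_caseD(1-3)[OF wc]
  show "0 \<le> V \<pi> s" "V \<pi> s \<le> 1 / (1 - \<gamma>)"
    unfolding u(2) using mdp.V_val_bounds[OF mdp_nominal[OF u(1) assms]] by auto
qed

text \<open>Here \<open>\<pi>'\<close> is evaluated under its own worst kernel, so its value is
  exact. That kernel need not be worst for \<open>\<pi>\<close>, and its backup of
  \<open>V \<pi>\<close> is only bounded by \<open>Q \<pi>\<close>.\<close>

lemma V_diff_le:
  assumes "\<pi> \<in> policies" "\<pi>' \<in> policies"
  obtains u where "u \<in> U" "\<And>s. V \<pi>' s - V \<pi> s
    \<le> (\<Sum>x\<in>UNIV. occ \<gamma> (PN + u) \<pi>' s x * (Q \<pi> $ x \<bullet> (\<pi>' $ x - \<pi> $ x)))"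
proof -
  obtain u where wc: "worst_case \<pi>' u"
    using worst_case_exists[OF assms(2)] .
  note u = worst_caseD(1,2)[OF wc]
  interpret mdp c \<gamma> "PN + u" \<pi>'
    using u(1) assms(2) by (rule mdp_nominal)
  have "(\<Sum>a\<in>UNIV. \<pi>' $ x $ a * (c x a + \<gamma> * (\<Sum>y\<in>UNIV. (PN + u) $ x $ a $ y * V \<pi> y))) - V \<pi> x
      \<le> Q \<pi> $ x \<bullet> (\<pi>' $ x - \<pi> $ x)" for x
  proof -
    have "(\<Sum>a\<in>UNIV. \<pi>' $ x $ a * (c x a + \<gamma> * (\<Sum>y\<in>UNIV. (PN + u) $ x $ a $ y * V \<pi> y)))
        \<le> (\<Sum>a\<in>UNIV. \<pi>' $ x $ a * Q \<pi> $ x $ a)"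
      by (intro sum_mono mult_left_mono Q_ge assms(1) u(1) \<pi>_nonneg)
    then show ?thesis
      by (simp add: V_eq_Q[OF assms(1)] inner_diff_right) (simp add: inner_vec_def mult.commute)
  qed
  then have "V \<pi>' s - V \<pi> s
      \<le> (\<Sum>x\<in>UNIV. occ \<gamma> (PN + u) \<pi>' s x * (Q \<pi> $ x \<bullet> (\<pi>' $ x - \<pi> $ x)))" for s
    unfolding u(2)[of s] performance_difference[of s "V \<pi>"]
    by (intro sum_mono mult_left_mono occ_nonneg) auto
  then show ?thesis
    using that u(1) by blast
qed

text \<open>Now the kernel is worst for \<open>\<pi>\<close>: its backup of \<open>V \<pi>\<close>
  equals \<open>Q \<pi>\<close>, and the inequality arises because it only bounds the value of
  \<open>\<pi>'\<close> from below. With \<open>\<pi>opt\<close> as \<open>\<pi>'\<close> the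
  weights are visitations of the optimal policy, as in the mismatch coefficient, but under a kernel
  that varies with \<open>\<pi>\<close>.\<close>

lemma V_diff_ge:
  assumes "\<pi> \<in> policies" "\<pi>' \<in> policies"
  obtains u where "u \<in> U" "\<And>s. V \<pi> s - V \<pi>' s
    \<le> (\<Sum>x\<in>UNIV. occ \<gamma> (PN + u) \<pi>' s x * (Q \<pi> $ x \<bullet> (\<pi> $ x - \<pi>' $ x)))"
proof -
  obtain u where wc: "worst_case \<pi> u"
    using worst_case_exists[OF assms(1)] .
  note u = worst_caseD(1,3)[OF wc]
  interpret mdp c \<gamma> "PN + u" \<pi>'
    using u(1) assms(2) by (rule mdp_nominal)
  have "(\<Sum>a\<in>UNIV. \<pi>' $ x $ a * (c x a + \<gamma> * (\<Sum>y\<in>UNIV. (PN + u) $ x $ a $ y * V \<pi> y))) - V \<pi> x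
      = - (Q \<pi> $ x \<bullet> (\<pi> $ x - \<pi>' $ x))" for x
    unfolding u(2)[symmetric]
    by (simp add: V_eq_Q[OF assms(1)] inner_diff_right) (simp add: inner_vec_def mult.commute)
  then have "V_val c \<gamma> (PN + u) \<pi>' s - V \<pi> s
      = - (\<Sum>x\<in>UNIV. occ \<gamma> (PN + u) \<pi>' s x * (Q \<pi> $ x \<bullet> (\<pi> $ x - \<pi>' $ x)))" for s
    unfolding performance_difference by (simp add: sum_negf)
  then show ?thesis
    using that[OF u(1)] V_val_le_V[OF u(1) assms(2)] by (smt (verit, best))
qed

lemma Q_bounds:
  assumes "\<pi> \<in> policies"
  shows "0 \<le> Q \<pi> $ s $ a" "Q \<pi> $ s $ a \<le> 1 / (1 - \<gamma>)"
proof -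
  obtain u where wc: "worst_case \<pi> u"
    using worst_case_exists[OF assms(1)] .
  note u = worst_caseD(1,3)[OF wc]
  interpret mdp c \<gamma> "PN + u" \<pi>
    using u(1) assms by (rule mdp_nominal)
  have "0 \<le> (\<Sum>x\<in>UNIV. (PN + u) $ s $ a $ x * V \<pi> x)"
    using P_nonneg V_bounds(1)[OF assms] by (intro sum_nonneg mult_nonneg_nonneg)
  then show "0 \<le> Q \<pi> $ s $ a"
    unfolding u(2) using cost(1)[of s a] discount by (simp add: less_imp_le)
  have "(\<Sum>x\<in>UNIV. (PN + u) $ s $ a $ x * V \<pi> x) \<le> (\<Sum>x\<in>UNIV. (PN + u) $ s $ a $ x * (1 / (1 - \<gamma>)))"
    using P_nonneg V_bounds(2)[OF assms] by (intro sum_mono mult_left_mono)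
  also have "\<dots> = 1 / (1 - \<gamma>)"
    unfolding sum_distrib_right[symmetric] P_sum by simp
  finally have "Q \<pi> $ s $ a \<le> 1 + \<gamma> * (1 / (1 - \<gamma>))"
    unfolding u(2) using cost(2)[of s a] discount by (intro add_mono mult_left_mono) auto
  also have "\<dots> = 1 / (1 - \<gamma>)"
    using discount by (simp add: field_simps)
  finally show "Q \<pi> $ s $ a \<le> 1 / (1 - \<gamma>)" .
qed

section \<open>Lipschitz continuity of the robust values\<close>

definition lip :: real where
  "lip = real CARD('a) / (1 - \<gamma>)\<^sup>2"

text \<open>A crude constant is enough, as it serves continuity and thereby measurability: each row
  of \<open>Q \<pi>\<close> has norm at most \<open>real CARD('a) / (1 - \<gamma>)\<close>, and the
  occupation weights add another factor \<open>1 / (1 - \<gamma>)\<close>.\<close>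

lemma V_diff_le_dist:
  assumes "\<pi> \<in> policies" "\<pi>' \<in> policies"
  shows "V \<pi>' s - V \<pi> s \<le> lip * dist \<pi>' \<pi>"
proof -
  obtain u where u: "u \<in> U" "\<And>s. V \<pi>' s - V \<pi> s
    \<le> (\<Sum>x\<in>UNIV. occ \<gamma> (PN + u) \<pi>' s x * (Q \<pi> $ x \<bullet> (\<pi>' $ x - \<pi> $ x)))"
    using V_diff_le[OF assms] by blast
  interpret mdp c \<gamma> "PN + u" \<pi>'
    using u(1) assms(2) by (rule mdp_nominal)
  have "Q \<pi> $ x \<bullet> (\<pi>' $ x - \<pi> $ x) \<le> real CARD('a) / (1 - \<gamma>) * dist \<pi>' \<pi>" for x
  proof -
    have "norm (Q \<pi> $ x) \<le> (\<Sum>a\<in>UNIV. \<bar>Q \<pi> $ x $ a\<bar>)"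
      by (rule norm_le_l1_cart)
    also have "\<dots> \<le> (\<Sum>a\<in>(UNIV::'a set). 1 / (1 - \<gamma>))"
      using Q_bounds[OF assms(1)] by (intro sum_mono) auto
    finally have "norm (Q \<pi> $ x) \<le> real CARD('a) / (1 - \<gamma>)" by simp
    moreover have "norm (\<pi>' $ x - \<pi> $ x) \<le> dist \<pi>' \<pi>"
      using Finite_Cartesian_Product.norm_nth_le[of "\<pi>' - \<pi>" x] by (simp add: dist_norm)
    ultimately have "norm (Q \<pi> $ x) * norm (\<pi>' $ x - \<pi> $ x) \<le> real CARD('a) / (1 - \<gamma>) * dist \<pi>' \<pi>"
      using discount by (intro mult_mono) auto
    then show ?thesis
      using norm_cauchy_schwarz order_trans by blast
  qed
  then have "V \<pi>' s - V \<pi> s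
      \<le> (\<Sum>x\<in>UNIV. occ \<gamma> (PN + u) \<pi>' s x * (real CARD('a) / (1 - \<gamma>) * dist \<pi>' \<pi>))"
    by (intro order_trans[OF u(2)] sum_mono mult_left_mono occ_nonneg)
  also have "\<dots> = lip * dist \<pi>' \<pi>"
    unfolding sum_distrib_right[symmetric] occ_sum by (simp add: lip_def power2_eq_square)
  finally show ?thesis .
qed

lemma lip_nonneg: "0 \<le> lip"
  by (simp add: lip_def)

lemma V_continuous: "continuous_on policies (\<lambda>\<pi>. V \<pi> s)"
proof (rule lipschitz_on_continuous_on[of lip], rule lipschitz_onI[OF _ lip_nonneg])
  fix \<pi> \<pi>' :: "('s, 'a) policy" assume "\<pi> \<in> policies" "\<pi>' \<in> policies"
  then show "dist (V \<pi> s) (V \<pi>' s) \<le> lip * dist \<pi> \<pi>'"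
    using V_diff_le_dist[of \<pi> \<pi>' s] V_diff_le_dist[of \<pi>' \<pi> s]
    by (simp add: dist_real_def abs_le_iff dist_commute)
qed

text \<open>Under the worst kernel of \<open>\<pi>'\<close>, replacing \<open>V \<pi>'\<close> by
  \<open>V \<pi>\<close> in the backup costs \<gamma> times the bound for the values; as \<gamma> is
  below one, the same constant serves.\<close>

lemma Q_diff_le_dist:
  assumes "\<pi> \<in> policies" "\<pi>' \<in> policies"
  shows "Q \<pi>' $ s $ a - Q \<pi> $ s $ a \<le> lip * dist \<pi>' \<pi>"
proof -
  obtain u where wc: "worst_case \<pi>' u"
    using worst_case_exists[OF assms(2)] .
  note u = worst_caseD(1,3)[OF wc]
  interpret mdp c \<gamma> "PN + u" \<pi>
    using u(1) assms(1) by (rule mdp_nominal)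
  have "(\<Sum>x\<in>UNIV. (PN + u) $ s $ a $ x * V \<pi>' x)
      \<le> (\<Sum>x\<in>UNIV. (PN + u) $ s $ a $ x * (V \<pi> x + lip * dist \<pi>' \<pi>))"
    using V_diff_le_dist[OF assms] by (intro expected_mono u(1)) (smt (verit))
  also have "\<dots> = (\<Sum>x\<in>UNIV. (PN + u) $ s $ a $ x * V \<pi> x) + lip * dist \<pi>' \<pi>"
    unfolding distrib_left sum.distrib sum_distrib_right[symmetric] P_sum by simp
  finally have "Q \<pi>' $ s $ a
      \<le> c s a + \<gamma> * (\<Sum>x\<in>UNIV. (PN + u) $ s $ a $ x * V \<pi> x) + \<gamma> * (lip * dist \<pi>' \<pi>)"
    unfolding u(2) using discount by (simp add: distrib_left[symmetric])
  also have "\<dots> \<le> Q \<pi> $ s $ a + 1 * (lip * dist \<pi>' \<pi>)"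
    using Q_ge[OF assms(1) u(1), of s a] discount lip_nonneg
    by (intro add_mono mult_right_mono) auto
  finally show ?thesis by simp
qed

lemma Q_continuous: "continuous_on policies Q"
proof -
  have "continuous_on policies (\<lambda>\<pi>. Q \<pi> $ s $ a)" for s a
  proof (rule lipschitz_on_continuous_on[of lip], rule lipschitz_onI[OF _ lip_nonneg])
    fix \<pi> \<pi>' :: "('s, 'a) policy" assume "\<pi> \<in> policies" "\<pi>' \<in> policies"
    then show "dist (Q \<pi> $ s $ a) (Q \<pi>' $ s $ a) \<le> lip * dist \<pi> \<pi>'"
      using Q_diff_le_dist[of \<pi> \<pi>' s] Q_diff_le_dist[of \<pi>' \<pi> s]
      by (simp add: dist_real_def abs_le_iff dist_commute)
  qed
  then have "continuous_on policies (\<lambda>\<pi>. \<chi> s a. Q \<pi> $ s $ a)"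
    by (intro continuous_on_vec_lambda)
  then show ?thesis by simp
qed

end

section \<open>Pathwise analysis of the proximal steps\<close>

lemma closed_prob_simplex: "closed (prob_simplex :: (real^'n) set)"
  unfolding prob_simplex_def
  by (intro closed_Collect_conj closed_Collect_all closed_Collect_le closed_Collect_eq)
    (auto intro!: continuous_intros)

lemma convex_prob_simplex: "convex (prob_simplex :: (real^'n) set)"
  unfolding prob_simplex_def
  by (rule convexI) (auto simp: sum.distrib sum_distrib_left[symmetric])

lemma inner_simplex_diff_le:
  fixes x :: "real^'n"
  assumes "p \<in> prob_simplex" "q \<in> prob_simplex" "\<And>i. \<bar>x $ i\<bar> \<le> B"
  shows "x \<bullet> (p - q) \<le> 2 * B"
proof -
  have "x $ i * (p $ i - q $ i) \<le> B * p $ i + B * q $ i" for i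
  proof -
    have "x $ i * p $ i \<le> B * p $ i" "- x $ i * q $ i \<le> B * q $ i"
      using assms(3)[of i] prob_simplex_nonneg[OF assms(1)] prob_simplex_nonneg[OF assms(2)]
      by (intro mult_right_mono; auto)+
    then show ?thesis by (simp add: right_diff_distrib)
  qed
  then have "x \<bullet> (p - q) \<le> (\<Sum>i\<in>UNIV. B * p $ i + B * q $ i)"
    by (simp add: inner_vec_def sum_mono)
  also have "\<dots> = 2 * B"
    unfolding sum.distrib sum_distrib_left[symmetric]
    using prob_simplex_sum[OF assms(1)] prob_simplex_sum[OF assms(2)] by simp
  finally show ?thesis .
qed

lemma norm_simplex_diff_le:
  assumes "p \<in> prob_simplex" "q \<in> prob_simplex"
  shows "norm (p - q) \<le> sqrt 2"
proof -
  have le1: "r $ i \<le> 1" if "r \<in> prob_simplex" for r :: "real^'n" and i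
    using member_le_sum[of i UNIV "\<lambda>i. r $ i"] prob_simplex_nonneg[OF that] prob_simplex_sum[OF that]
    by simp
  have "\<bar>(p - q) $ i\<bar> \<le> 1" for i
    using le1[OF assms(1), of i] le1[OF assms(2), of i]
      prob_simplex_nonneg[OF assms(1), of i] prob_simplex_nonneg[OF assms(2), of i] by simp
  \<comment> \<open>The bound of \<open>inner_simplex_diff_le\<close> with \<open>p - q\<close>
    paired with itself.\<close>
  then have "(p - q) \<bullet> (p - q) \<le> 2 * 1"
    using assms by (rule inner_simplex_diff_le[rotated -1])
  then show ?thesis
    by (simp add: norm_eq_sqrt_inner)
qed

text \<open>Completing the square turns the objective into a squared distance plus a constant; the
  half in \<open>\<eta> / 2\<close> is due to the squared norm having no factor one half. As a
  projection the step is continuous in its data and satisfies an angle condition.\<close>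

lemma proximal_step_closest:
  fixes g p\<^sub>0 p :: "real^'n"
  assumes "\<eta> > 0"
    and min: "is_arg_min (\<lambda>p. \<eta> * (g \<bullet> p) + (norm (p - p\<^sub>0))\<^sup>2) (\<lambda>p. p \<in> prob_simplex) p"
  shows "p = closest_point prob_simplex (p\<^sub>0 - (\<eta> / 2) *\<^sub>R g)"
proof (rule closest_point_unique[OF convex_prob_simplex closed_prob_simplex])
  show "p \<in> prob_simplex"
    using min by (simp add: is_arg_min_linorder)
  have sq: "(dist (p\<^sub>0 - (\<eta> / 2) *\<^sub>R g) z)\<^sup>2
      = \<eta> * (g \<bullet> z) + (norm (z - p\<^sub>0))\<^sup>2 + (\<eta>\<^sup>2 / 4 * (g \<bullet> g) - \<eta> * (g \<bullet> p\<^sub>0))" for z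
    unfolding dist_norm power2_norm_eq_inner
    by (simp add: inner_diff_left inner_diff_right inner_add_left inner_add_right inner_commute
        power2_eq_square algebra_simps)
  show "\<forall>z\<in>prob_simplex. dist (p\<^sub>0 - (\<eta> / 2) *\<^sub>R g) p \<le> dist (p\<^sub>0 - (\<eta> / 2) *\<^sub>R g) z"
  proof
    fix z :: "real^'n" assume "z \<in> prob_simplex"
    then have "(dist (p\<^sub>0 - (\<eta> / 2) *\<^sub>R g) p)\<^sup>2 \<le> (dist (p\<^sub>0 - (\<eta> / 2) *\<^sub>R g) z)\<^sup>2"
      using min unfolding sq by (simp add: is_arg_min_linorder)
    then show "dist (p\<^sub>0 - (\<eta> / 2) *\<^sub>R g) p \<le> dist (p\<^sub>0 - (\<eta> / 2) *\<^sub>R g) z"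
      by (rule power2_le_imp_le) simp
  qed
qed

text \<open>At the projection, the vector to the projected point makes no acute angle with any
  direction into the simplex.\<close>

lemma proximal_step_variational:
  fixes g p\<^sub>0 p :: "real^'n"
  assumes "\<eta> > 0"
    and min: "is_arg_min (\<lambda>p. \<eta> * (g \<bullet> p) + (norm (p - p\<^sub>0))\<^sup>2) (\<lambda>p. p \<in> prob_simplex) p"
    and "z \<in> prob_simplex"
  shows "\<eta> * (g \<bullet> (p - z)) \<le> 2 * ((p - p\<^sub>0) \<bullet> (z - p))"
proof -
  have "(p\<^sub>0 - (\<eta> / 2) *\<^sub>R g - p) \<bullet> (z - p) \<le> 0"
    using closest_point_dot[OF convex_prob_simplex closed_prob_simplex assms(3),
        of "p\<^sub>0 - (\<eta> / 2) *\<^sub>R g"]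
    unfolding proximal_step_closest[OF assms(1,2), symmetric] .
  then show ?thesis
    by (simp add: inner_diff_left inner_diff_right algebra_simps)
qed

context robust_mdp
begin

lemma policies_simplex: "\<pi> \<in> policies \<Longrightarrow> \<pi> $ s \<in> prob_simplex"
  by (simp add: policies_def)

section \<open>One proximal step with an inexact Q-function\<close>

context
  fixes \<eta> :: real and q :: "real^'a^'s" and \<pi> \<pi>' :: "('s, 'a) policy" and \<delta> :: real
  assumes eta: "\<eta> > 0"
    and \<pi>: "\<pi> \<in> policies"
    and min: "\<And>s. is_arg_min (\<lambda>p. \<eta> * (q $ s \<bullet> p) + (norm (p - \<pi> $ s))\<^sup>2)
        (\<lambda>p. p \<in> prob_simplex) (\<pi>' $ s)"
  defines "\<delta> \<equiv> infnorm (q - Q \<pi>)"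
begin

lemma step_policy: "\<pi>' \<in> policies"
  using min by (simp add: policies_def is_arg_min_linorder)

lemma estimate_error_le:
  assumes "x \<in> prob_simplex" "y \<in> prob_simplex"
  shows "(Q \<pi> $ s - q $ s) \<bullet> (x - y) \<le> 2 * \<delta>"
proof (rule inner_simplex_diff_le[OF assms])
  show "\<bar>(Q \<pi> $ s - q $ s) $ a\<bar> \<le> \<delta>" for a
    using abs_component_le_infnorm[of "q - Q \<pi>" s a] by (simp add: \<delta>_def abs_minus_commute)
qed

lemma step_decrease: "Q \<pi> $ s \<bullet> (\<pi>' $ s - \<pi> $ s) \<le> 2 * \<delta> - 2 / \<eta> * (norm (\<pi>' $ s - \<pi> $ s))\<^sup>2"
proof -
  let ?d = "\<pi>' $ s - \<pi> $ s"
  \<comment> \<open>The old policy is the competitor, which makes the right-hand side a negative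
    multiple of the squared step length.\<close>
  have "\<eta> * (q $ s \<bullet> ?d) \<le> 2 * (?d \<bullet> (\<pi> $ s - \<pi>' $ s))"
    by (rule proximal_step_variational[OF eta min policies_simplex[OF \<pi>]])
  also have "?d \<bullet> (\<pi> $ s - \<pi>' $ s) = - (norm ?d)\<^sup>2"
    by (simp add: power2_norm_eq_inner inner_diff_left inner_diff_right)
  finally have "q $ s \<bullet> ?d \<le> - (2 / \<eta> * (norm ?d)\<^sup>2)"
    using eta by (simp add: field_simps)
  moreover have "(Q \<pi> $ s - q $ s) \<bullet> ?d \<le> 2 * \<delta>"
    using \<pi> step_policy by (intro estimate_error_le policies_simplex)
  ultimately show ?thesis
    by (simp add: inner_diff_left)
qed

text \<open>
  Up to \<open>2 \<delta>\<close> all advantages are nonpositive, so that all states but \<open>s\<close> itself, which is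
  visited with weight at least one, can be dropped from the performance difference.
\<close>

lemma V_step_le: "V \<pi>' s - V \<pi> s \<le> Q \<pi> $ s \<bullet> (\<pi>' $ s - \<pi> $ s) + 2 * \<delta> / (1 - \<gamma>) - 2 * \<delta>"
proof -
  define y where "y x = Q \<pi> $ x \<bullet> (\<pi>' $ x - \<pi> $ x) - 2 * \<delta>" for x
  have y: "y x \<le> 0" for x
  proof -
    have "0 \<le> 2 / \<eta> * (norm (\<pi>' $ x - \<pi> $ x))\<^sup>2"
      using eta by simp
    then show ?thesis
      using step_decrease[of x] by (simp add: y_def)
  qed
  obtain u where u: "u \<in> U" "\<And>s. V \<pi>' s - V \<pi> s
      \<le> (\<Sum>x\<in>UNIV. occ \<gamma> (PN + u) \<pi>' s x * (Q \<pi> $ x \<bullet> (\<pi>' $ x - \<pi> $ x)))"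
    using V_diff_le[OF \<pi> step_policy] by blast
  interpret mdp c \<gamma> "PN + u" \<pi>'
    using u(1) step_policy by (rule mdp_nominal)
  let ?o = "occ \<gamma> (PN + u) \<pi>' s"
  have "(\<Sum>x\<in>UNIV. ?o x * (Q \<pi> $ x \<bullet> (\<pi>' $ x - \<pi> $ x)))
      = (\<Sum>x\<in>UNIV. ?o x * y x) + (\<Sum>x\<in>UNIV. ?o x) * (2 * \<delta>)"
    by (simp add: y_def right_diff_distrib sum_subtractf sum_distrib_right)
  also have "(\<Sum>x\<in>UNIV. ?o x * y x) = ?o s * y s + (\<Sum>x\<in>UNIV - {s}. ?o x * y x)"
    by (simp add: sum.remove)
  also have "\<dots> \<le> 1 * y s + 0"
    using y occ_nonneg occ_diag
    by (intro add_mono mult_right_mono_neg sum_nonpos mult_nonneg_nonpos) auto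
  finally show ?thesis
    using u(2)[of s] by (simp add: occ_sum y_def)
qed

lemma step_length_le: "2 / \<eta> * (norm (\<pi>' $ s - \<pi> $ s))\<^sup>2 \<le> V \<pi> s - V \<pi>' s + 2 * \<delta> / (1 - \<gamma>)"
  using step_decrease[of s] V_step_le[of s] by simp

text \<open>The difference is split at \<open>\<pi>' $ s\<close>: \<open>V_step_le\<close> controls
  the part from \<open>\<pi>\<close> to \<open>\<pi>'\<close>, the variational inequality the part
  from \<open>\<pi>'\<close> to \<open>p\<close>. The estimation error \<open>2 * \<delta>\<close>
  of the second part cancels the \<open>- 2 * \<delta>\<close> of the first.\<close>

lemma advantage_le:
  assumes p: "p \<in> policies"
  shows "Q \<pi> $ s \<bullet> (\<pi> $ s - p $ s)
    \<le> (V \<pi> s - V \<pi>' s + 2 * \<delta> / (1 - \<gamma>)) + 2 * sqrt 2 / \<eta> * norm (\<pi>' $ s - \<pi> $ s)"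
proof -
  let ?d = "\<pi>' $ s - \<pi> $ s"
  have "\<eta> * (q $ s \<bullet> (\<pi>' $ s - p $ s)) \<le> 2 * (?d \<bullet> (p $ s - \<pi>' $ s))"
    by (rule proximal_step_variational[OF eta min policies_simplex[OF p]])
  also have "?d \<bullet> (p $ s - \<pi>' $ s) \<le> norm ?d * norm (p $ s - \<pi>' $ s)"
    by (rule norm_cauchy_schwarz)
  \<comment> \<open>The distance to \<open>p\<close> is not tracked but replaced by the bound
    \<open>sqrt 2\<close> on distances in the simplex.\<close>
  also have "\<dots> \<le> norm ?d * sqrt 2"
    using p step_policy by (intro mult_left_mono norm_simplex_diff_le policies_simplex) auto
  finally have "q $ s \<bullet> (\<pi>' $ s - p $ s) \<le> 2 * sqrt 2 / \<eta> * norm ?d"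
    using eta by (simp add: field_simps)
  moreover have "(Q \<pi> $ s - q $ s) \<bullet> (\<pi>' $ s - p $ s) \<le> 2 * \<delta>"
    using p step_policy by (intro estimate_error_le policies_simplex)
  ultimately show ?thesis
    using V_step_le[of s] by (simp add: inner_diff_left inner_diff_right)
qed

end

section \<open>Visitation weights and the mismatch coefficient\<close>

lemma visit_from_occ:
  assumes "u \<in> U" "\<pi> \<in> policies"
  shows "visit_from \<gamma> (PN + u) \<pi> \<rho> x = (1 - \<gamma>) * (\<Sum>s\<in>UNIV. \<rho> $ s * occ \<gamma> (PN + u) \<pi> s x)"
  by (simp add: visit_from_def mdp.visit_eq[OF mdp_nominal[OF assms]] sum_distrib_left mult_ac)

lemma visit_from_nonneg:
  assumes "u \<in> U" "\<pi> \<in> policies" "\<rho> \<in> prob_simplex"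
  shows "0 \<le> visit_from \<gamma> (PN + u) \<pi> \<rho> x"
  unfolding visit_from_occ[OF assms(1,2)] using discount prob_simplex_nonneg[OF assms(3)]
  by (intro mult_nonneg_nonneg sum_nonneg mdp.occ_nonneg[OF mdp_nominal[OF assms(1,2)]]) auto

lemma visit_from_sum:
  assumes "u \<in> U" "\<pi> \<in> policies" "\<rho> \<in> prob_simplex"
  shows "(\<Sum>x\<in>UNIV. visit_from \<gamma> (PN + u) \<pi> \<rho> x) = 1"
proof -
  have "(\<Sum>x\<in>UNIV. visit_from \<gamma> (PN + u) \<pi> \<rho> x)
      = (1 - \<gamma>) * (\<Sum>s\<in>UNIV. \<Sum>x\<in>UNIV. \<rho> $ s * occ \<gamma> (PN + u) \<pi> s x)"
    unfolding visit_from_occ[OF assms(1,2)] sum_distrib_left by (rule sum.swap)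
  also have "\<dots> = 1"
    unfolding sum_distrib_left[symmetric] mdp.occ_sum[OF mdp_nominal[OF assms(1,2)]]
    using discount prob_simplex_sum[OF assms(3)] by (simp flip: sum_divide_distrib)
  finally show ?thesis .
qed

context
  fixes \<rho> :: "real^'s" and \<pi>opt :: "('s, 'a) policy" and M :: real
  assumes rho: "\<rho> \<in> prob_simplex"
    and opt: "optimal_robust c \<gamma> PN U \<pi>opt"
    and M: "mismatch \<gamma> PN U \<pi>opt \<rho> < \<infinity>" "M = enn2real (mismatch \<gamma> PN U \<pi>opt \<rho>)"
begin

abbreviation f :: "('s, 'a) policy \<Rightarrow> real" where
  "f \<equiv> f_obj c \<gamma> PN U \<rho>"

lemma opt_policy: "\<pi>opt \<in> policies"
  using opt by (simp add: optimal_robust_def)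

lemma f_opt_le: "\<pi> \<in> policies \<Longrightarrow> f \<pi>opt \<le> f \<pi>"
  unfolding f_obj_def using opt prob_simplex_nonneg[OF rho]
  by (intro sum_mono mult_left_mono) (auto simp: optimal_robust_def)

lemma f_bounds:
  assumes "\<pi> \<in> policies"
  shows "0 \<le> f \<pi>" "f \<pi> \<le> 1 / (1 - \<gamma>)"
proof -
  show "0 \<le> f \<pi>"
    unfolding f_obj_def using V_bounds[OF assms] prob_simplex_nonneg[OF rho]
    by (intro sum_nonneg mult_nonneg_nonneg) auto
  have "f \<pi> \<le> (\<Sum>s\<in>UNIV. \<rho> $ s * (1 / (1 - \<gamma>)))"
    unfolding f_obj_def using V_bounds[OF assms] prob_simplex_nonneg[OF rho]
    by (intro sum_mono mult_left_mono) auto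
  also have "\<dots> = 1 / (1 - \<gamma>)"
    unfolding sum_distrib_right[symmetric] using prob_simplex_sum[OF rho] by simp
  finally show "f \<pi> \<le> 1 / (1 - \<gamma>)" .
qed

lemma visit_from_le:
  assumes "u \<in> U"
  shows "visit_from \<gamma> (PN + u) \<pi>opt \<rho> x \<le> M * \<rho> $ x"
proof -
  let ?v = "visit_from \<gamma> (PN + u) \<pi>opt \<rho> x"
  have "ennreal ?v / ennreal (\<rho> $ x) \<le> mismatch \<gamma> PN U \<pi>opt \<rho>"
    unfolding mismatch_def using assms by (intro SUP_upper2[of u] SUP_upper) auto
  also have "\<dots> = ennreal M"
    using M by simp
  finally have le: "ennreal ?v / ennreal (\<rho> $ x) \<le> ennreal M" .
  have M0: "0 \<le> M" and r0: "0 \<le> \<rho> $ x" and v0: "0 \<le> ?v"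
    using M(2) prob_simplex_nonneg[OF rho] visit_from_nonneg[OF assms opt_policy rho] by auto
  show ?thesis
  proof (cases "\<rho> $ x = 0")
    case True
    \<comment> \<open>Where \<open>\<rho>\<close> vanishes, a positive visitation would make the
      mismatch infinite.\<close>
    have "?v = 0"
    proof (rule ccontr)
      assume "?v \<noteq> 0"
      with le True v0 show False
        by (simp add: ennreal_divide_zero top_unique)
    qed
    with True show ?thesis by simp
  next
    case False
    with r0 have "0 < \<rho> $ x" by simp
    with le M0 v0 have "?v / \<rho> $ x \<le> M"
      by (simp add: divide_ennreal)
    with \<open>0 < \<rho> $ x\<close> show ?thesis
      by (simp add: pos_divide_le_eq)
  qed
qed

text \<open>Visitation measure and \<open>\<rho>\<close> both have mass one, so summing
  \<open>visit_from_le\<close> over the states gives the bound. It pays for the index shift in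
  \<open>pathwise_bound\<close>.\<close>

lemma M_ge_1: "1 \<le> M"
proof -
  obtain u where u: "u \<in> U"
    using U_nonempty by auto
  have "1 = (\<Sum>x\<in>UNIV. visit_from \<gamma> (PN + u) \<pi>opt \<rho> x)"
    by (simp add: visit_from_sum[OF u opt_policy rho])
  also have "\<dots> \<le> (\<Sum>x\<in>UNIV. M * \<rho> $ x)"
    by (intro sum_mono visit_from_le u)
  also have "\<dots> = M"
    unfolding sum_distrib_left[symmetric] by (simp add: prob_simplex_sum[OF rho])
  finally show ?thesis .
qed

text \<open>The advantages have no sign, so their weights cannot be enlarged directly. Each is
  bounded by a nonnegative \<open>y x\<close>, whose weight may grow to
  \<open>M * \<rho> $ x\<close>, plus a term common to all states, for which the weights sum to
  one.\<close>

lemma gap_step: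
  fixes q :: "real^'a^'s"
  assumes eta: "\<eta> > 0" and \<pi>: "\<pi> \<in> policies"
    and min: "\<And>s. is_arg_min (\<lambda>p. \<eta> * (q $ s \<bullet> p) + (norm (p - \<pi> $ s))\<^sup>2)
        (\<lambda>p. p \<in> prob_simplex) (\<pi>' $ s)"
    and G: "\<And>s. norm (\<pi>' $ s - \<pi> $ s) \<le> G"
  shows "(1 - \<gamma>) * (f \<pi> - f \<pi>opt)
    \<le> M * (f \<pi> - f \<pi>') + 2 * M / (1 - \<gamma>) * infnorm (q - Q \<pi>) + 2 * sqrt 2 / \<eta> * G"
proof -
  let ?\<delta> = "infnorm (q - Q \<pi>)"
  define y where "y x = V \<pi> x - V \<pi>' x + 2 * ?\<delta> / (1 - \<gamma>)" for x
  have y: "0 \<le> y x" for x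
  proof -
    have "0 \<le> 2 / \<eta> * (norm (\<pi>' $ x - \<pi> $ x))\<^sup>2"
      using eta by simp
    with step_length_le[OF eta \<pi> min, of x] show ?thesis
      by (simp add: y_def)
  qed
  obtain u where u: "u \<in> U" "\<And>s. V \<pi> s - V \<pi>opt s
      \<le> (\<Sum>x\<in>UNIV. occ \<gamma> (PN + u) \<pi>opt s x * (Q \<pi> $ x \<bullet> (\<pi> $ x - \<pi>opt $ x)))"
    using V_diff_ge[OF \<pi> opt_policy] by blast
  let ?v = "\<lambda>x. visit_from \<gamma> (PN + u) \<pi>opt \<rho> x"
  have adv: "Q \<pi> $ x \<bullet> (\<pi> $ x - \<pi>opt $ x) \<le> y x + 2 * sqrt 2 / \<eta> * G" for x
  proof -
    have "2 * sqrt 2 / \<eta> * norm (\<pi>' $ x - \<pi> $ x) \<le> 2 * sqrt 2 / \<eta> * G"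
      using eta G by (intro mult_left_mono) auto
    with advantage_le[OF eta \<pi> min opt_policy, of x] show ?thesis
      by (simp add: y_def)
  qed
  have "f \<pi> - f \<pi>opt = (\<Sum>s\<in>UNIV. \<rho> $ s * (V \<pi> s - V \<pi>opt s))"
    by (simp add: f_obj_def right_diff_distrib sum_subtractf)
  also have "\<dots> \<le> (\<Sum>s\<in>UNIV. \<rho> $ s *
      (\<Sum>x\<in>UNIV. occ \<gamma> (PN + u) \<pi>opt s x * (Q \<pi> $ x \<bullet> (\<pi> $ x - \<pi>opt $ x))))"
    using u(2) prob_simplex_nonneg[OF rho] by (intro sum_mono mult_left_mono)
  also have "\<dots> = (\<Sum>x\<in>UNIV. (\<Sum>s\<in>UNIV. \<rho> $ s * occ \<gamma> (PN + u) \<pi>opt s x) *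
      (Q \<pi> $ x \<bullet> (\<pi> $ x - \<pi>opt $ x)))"
    unfolding sum_distrib_left sum_distrib_right by (subst sum.swap) (simp add: mult.assoc)
  finally have "(1 - \<gamma>) * (f \<pi> - f \<pi>opt)
      \<le> (1 - \<gamma>) * (\<Sum>x\<in>UNIV. (\<Sum>s\<in>UNIV. \<rho> $ s * occ \<gamma> (PN + u) \<pi>opt s x) *
      (Q \<pi> $ x \<bullet> (\<pi> $ x - \<pi>opt $ x)))"
    using discount by (intro mult_left_mono) auto
  also have "\<dots> = (\<Sum>x\<in>UNIV. ?v x * (Q \<pi> $ x \<bullet> (\<pi> $ x - \<pi>opt $ x)))"
    unfolding visit_from_occ[OF u(1) opt_policy] mult.assoc by (rule sum_distrib_left)
  also have "\<dots> \<le> (\<Sum>x\<in>UNIV. ?v x * (y x + 2 * sqrt 2 / \<eta> * G))"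
    by (intro sum_mono mult_left_mono adv visit_from_nonneg u(1) opt_policy rho)
  also have "\<dots> = (\<Sum>x\<in>UNIV. ?v x * y x) + 2 * sqrt 2 / \<eta> * G"
    unfolding distrib_left sum.distrib sum_distrib_right[symmetric]
      visit_from_sum[OF u(1) opt_policy rho] by simp
  also have "(\<Sum>x\<in>UNIV. ?v x * y x) \<le> (\<Sum>x\<in>UNIV. M * \<rho> $ x * y x)"
    by (intro sum_mono mult_right_mono visit_from_le u(1) y)
  also have "\<dots> = M * (\<Sum>x\<in>UNIV. \<rho> $ x * (V \<pi> x - V \<pi>' x) + \<rho> $ x * (2 * ?\<delta> / (1 - \<gamma>)))"
    by (simp add: sum_distrib_left y_def mult.assoc distrib_left)
  also have "\<dots> = M * ((f \<pi> - f \<pi>') + 2 * ?\<delta> / (1 - \<gamma>))"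
    unfolding sum.distrib sum_distrib_right[symmetric] prob_simplex_sum[OF rho]
    by (simp add: f_obj_def right_diff_distrib sum_subtractf)
  finally show ?thesis
    by (simp add: distrib_left mult_ac)
qed

lemma pathwise_bound:
  fixes k :: nat
  assumes eta: "\<eta> > 0" and init: "\<pi> 0 \<in> policies"
    and srpmd: "srpmd (\<lambda>_. \<eta>) est \<pi>0 x \<pi>"
  defines "D \<equiv> \<Sum>t<k. infnorm (est t (\<pi> t) (x t) - Q (\<pi> t))"
  shows "(\<Sum>t=1..k. f (\<pi> t) - f \<pi>opt) \<le> M / (1 - \<gamma>) * (f (\<pi> 0) - f \<pi>opt)
    + 2 * M / (1 - \<gamma>)\<^sup>2 * D + sqrt (4 * k * CARD('s) / (\<eta> * (1 - \<gamma>) ^ 3)) * sqrt (1 + 2 * D)"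
proof -
  have min: "is_arg_min (\<lambda>p. \<eta> * (est t (\<pi> t) (x t) $ s \<bullet> p) + (norm (p - \<pi> t $ s))\<^sup>2)
      (\<lambda>p. p \<in> prob_simplex) (\<pi> (Suc t) $ s)" for t s
    using srpmd unfolding srpmd_def by blast
  have pol: "\<pi> t \<in> policies" for t
    by (induction t) (use init step_policy[OF eta _ min] in auto)
  define \<delta> where "\<delta> t = infnorm (est t (\<pi> t) (x t) - Q (\<pi> t))" for t
  define n where "n t s = norm (\<pi> (Suc t) $ s - \<pi> t $ s)" for t s
  \<comment> \<open>The Euclidean norm over states, rather than the maximum: its square splits into
    the states, where the squared step lengths are summable. This costs the factor
    \<open>CARD('s)\<close>.\<close>
  define G where "G t = sqrt (\<Sum>s\<in>UNIV. (n t s)\<^sup>2)" for t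
  let ?g = "1 - \<gamma>"
  have g: "0 < ?g" "?g < 1"
    using discount by auto
  have D: "D = (\<Sum>t<k. \<delta> t)" "0 \<le> D"
    by (auto simp: D_def \<delta>_def intro!: sum_nonneg infnorm_pos_le)
  have "n t s \<le> G t" for t s
    unfolding G_def by (intro real_le_rsqrt member_le_sum) auto
  then have step: "?g * (f (\<pi> t) - f \<pi>opt)
      \<le> M * (f (\<pi> t) - f (\<pi> (Suc t))) + 2 * M / ?g * \<delta> t + 2 * sqrt 2 / \<eta> * G t" for t
    unfolding \<delta>_def n_def by (intro gap_step[OF eta pol min])
  have "?g * (\<Sum>t<k. f (\<pi> t) - f \<pi>opt)
      \<le> (\<Sum>t<k. M * (f (\<pi> t) - f (\<pi> (Suc t))) + 2 * M / ?g * \<delta> t + 2 * sqrt 2 / \<eta> * G t)"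
    unfolding sum_distrib_left by (intro sum_mono step)
  also have "\<dots> = M * (f (\<pi> 0) - f (\<pi> k)) + 2 * M / ?g * D + 2 * sqrt 2 / \<eta> * (\<Sum>t<k. G t)"
    unfolding sum.distrib sum_distrib_left[symmetric] D
    by (simp add: sum_lessThan_telescope'[of "\<lambda>t. f (\<pi> t)"])
  finally have "(\<Sum>t<k. f (\<pi> t) - f \<pi>opt)
      \<le> (M * (f (\<pi> 0) - f (\<pi> k)) + 2 * M / ?g * D + 2 * sqrt 2 / \<eta> * (\<Sum>t<k. G t)) / ?g"
    unfolding pos_le_divide_eq[OF g(1)] by (simp only: mult.commute)
  then have gap: "(\<Sum>t<k. f (\<pi> t) - f \<pi>opt)
      \<le> M / ?g * (f (\<pi> 0) - f (\<pi> k)) + 2 * M / ?g\<^sup>2 * D + 2 * sqrt 2 / \<eta> * (\<Sum>t<k. G t) / ?g"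
    by (simp add: add_divide_distrib power2_eq_square)
  \<comment> \<open>Within each state the decreases telescope. The summand 1 stems from the bound
    \<open>1 / (1 - \<gamma>)\<close> on the initial value, and the final value is
    nonnegative.\<close>
  have lens: "(\<Sum>t<k. (n t s)\<^sup>2) \<le> \<eta> / 2 * ((1 + 2 * D) / ?g)" for s
  proof -
    have "2 / \<eta> * (\<Sum>t<k. (n t s)\<^sup>2) \<le> (\<Sum>t<k. V (\<pi> t) s - V (\<pi> (Suc t)) s + 2 / ?g * \<delta> t)"
      unfolding sum_distrib_left
      using step_length_le[OF eta pol min] by (intro sum_mono) (simp add: n_def \<delta>_def)
    also have "\<dots> = V (\<pi> 0) s - V (\<pi> k) s + 2 / ?g * D"
      unfolding sum.distrib sum_distrib_left[symmetric] D
      by (simp add: sum_lessThan_telescope'[of "\<lambda>t. V (\<pi> t) s"])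
    also have "\<dots> \<le> 1 / ?g + 2 / ?g * D"
      using V_bounds(2)[OF pol, of 0 s] V_bounds(1)[OF pol, of k s] by linarith
    also have "\<dots> = (1 + 2 * D) / ?g"
      by (simp add: add_divide_distrib)
    finally have "\<eta> / 2 * (2 / \<eta> * (\<Sum>t<k. (n t s)\<^sup>2)) \<le> \<eta> / 2 * ((1 + 2 * D) / ?g)"
      using eta by (intro mult_left_mono) auto
    then show ?thesis
      using eta by simp
  qed
  \<comment> \<open>Cauchy-Schwarz over the iterations, followed by an exchange of the sums over
    iterations and states.\<close>
  have "(\<Sum>t<k. G t)\<^sup>2 \<le> (\<Sum>t<k. (G t)\<^sup>2) * k"
    using sum_squared_le_sum_of_squares[of G "{..<k}"] by simp
  also have "(\<Sum>t<k. (G t)\<^sup>2) = (\<Sum>s\<in>UNIV. \<Sum>t<k. (n t s)\<^sup>2)"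
    unfolding G_def by (subst sum.swap) (simp add: sum_nonneg)
  also have "\<dots> \<le> (\<Sum>s\<in>(UNIV :: 's set). \<eta> / 2 * ((1 + 2 * D) / ?g))"
    by (intro sum_mono lens)
  finally have G2: "(\<Sum>t<k. G t)\<^sup>2 \<le> CARD('s) * (\<eta> / 2 * ((1 + 2 * D) / ?g)) * k"
    by (simp add: mult_right_mono)
  have "2 * sqrt 2 / \<eta> * (\<Sum>t<k. G t) / ?g
      \<le> sqrt (4 * k * CARD('s) / (\<eta> * ?g ^ 3) * (1 + 2 * D))"
  proof (rule real_le_rsqrt)
    have "(2 * sqrt 2 / \<eta> * (\<Sum>t<k. G t) / ?g)\<^sup>2 = 8 / (\<eta>\<^sup>2 * ?g\<^sup>2) * (\<Sum>t<k. G t)\<^sup>2"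
      by (simp add: power_mult_distrib power_divide)
    also have "\<dots> \<le> 8 / (\<eta>\<^sup>2 * ?g\<^sup>2) * (CARD('s) * (\<eta> / 2 * ((1 + 2 * D) / ?g)) * k)"
      by (intro mult_left_mono G2) auto
    also have "\<dots> = 4 * k * CARD('s) / (\<eta> * ?g ^ 3) * (1 + 2 * D)"
      using eta g by (simp add: power2_eq_square power3_eq_cube divide_simps)
    finally show "(2 * sqrt 2 / \<eta> * (\<Sum>t<k. G t) / ?g)\<^sup>2
        \<le> 4 * k * CARD('s) / (\<eta> * ?g ^ 3) * (1 + 2 * D)" .
  qed
  then have last: "2 * sqrt 2 / \<eta> * (\<Sum>t<k. G t) / ?g
      \<le> sqrt (4 * k * CARD('s) / (\<eta> * ?g ^ 3)) * sqrt (1 + 2 * D)"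
    by (simp only: real_sqrt_mult)
  have shift: "(\<Sum>t=1..k. f (\<pi> t) - f \<pi>opt) = (\<Sum>t<k. f (\<pi> t) - f \<pi>opt) - (f (\<pi> 0) - f (\<pi> k))"
  proof -
    have "(\<Sum>t=1..k. f (\<pi> t) - f \<pi>opt) = (\<Sum>t<k. f (\<pi> (Suc t)) - f \<pi>opt)"
      by (rule sum.reindex_bij_witness[of _ Suc "\<lambda>t. t - 1"]) auto
    also have "\<dots> = (\<Sum>t<k. f (\<pi> t) - f \<pi>opt) - (\<Sum>t<k. f (\<pi> t) - f (\<pi> (Suc t)))"
      by (simp add: sum_subtractf)
    finally show ?thesis
      by (simp only: sum_lessThan_telescope'[of "\<lambda>t. f (\<pi> t)"])
  qed
  \<comment> \<open>The index shift lowers the coefficient by one. It stays nonnegative, so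
    \<open>f (\<pi> k)\<close> may be replaced by the optimal value although \<open>f\<close> need
    not decrease along the iterates.\<close>
  have "(M / ?g - 1) * (f (\<pi> 0) - f (\<pi> k)) \<le> (M / ?g - 1) * (f (\<pi> 0) - f \<pi>opt)"
    using M_ge_1 g f_opt_le[OF pol, of k] by (intro mult_left_mono) (auto simp: pos_le_divide_eq)
  also have "\<dots> \<le> M / ?g * (f (\<pi> 0) - f \<pi>opt)"
    using f_opt_le[OF pol, of 0] by (simp add: left_diff_distrib)
  finally show ?thesis
    using gap last shift by (simp add: left_diff_distrib)
qed

end
end

section \<open>Measurability and expectations\<close>

lemma borel_measurable_vec_nth:
  "(\<lambda>v :: 'b::euclidean_space ^ 'n. v $ i) \<in> borel_measurable borel"
  by (intro borel_measurable_continuous_onI continuous_intros)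

lemma borel_measurable_vec_lambda:
  fixes F :: "'n::finite \<Rightarrow> 'c \<Rightarrow> 'b::euclidean_space"
  assumes "\<And>i. F i \<in> borel_measurable N"
  shows "(\<lambda>x. \<chi> i. F i x) \<in> borel_measurable N"
proof (subst borel_measurable_euclidean_space, intro ballI)
  fix b :: "'b ^ 'n" assume "b \<in> Basis"
  then obtain i u where b: "b = axis i u"
    by (auto simp: Basis_vec_def)
  show "(\<lambda>x. (\<chi> i. F i x) \<bullet> b) \<in> borel_measurable N"
    using assms[of i] by (simp add: b inner_axis)
qed

text \<open>An explicit function of the whole sample sequence. It yields measurability of the
  iterates and exhibits them as functions of the samples, from which the random index is
  independent.\<close>

primrec srpmd_iter ::
    "real \<Rightarrow> (nat \<Rightarrow> ('s::finite, 'a::finite) policy \<Rightarrow> 'x \<Rightarrow> real^'a^'s)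
      \<Rightarrow> ('s, 'a) policy \<Rightarrow> nat \<Rightarrow> (nat \<Rightarrow> 'x) \<Rightarrow> ('s, 'a) policy" where
  "srpmd_iter \<eta> est \<pi>0 0 x = \<pi>0"
| "srpmd_iter \<eta> est \<pi>0 (Suc t) x = (\<chi> s. closest_point prob_simplex
     (srpmd_iter \<eta> est \<pi>0 t x $ s - (\<eta> / 2) *\<^sub>R est t (srpmd_iter \<eta> est \<pi>0 t x) (x t) $ s))"

lemma srpmd_eq_iter:
  assumes "\<eta> > 0" "srpmd (\<lambda>_. \<eta>) est \<pi>0 x \<pi>"
  shows "\<pi> t = srpmd_iter \<eta> est \<pi>0 t x"
proof (induction t)
  case 0
  show ?case using assms(2) by (simp add: srpmd_def)
next
  case (Suc t)
  have "\<pi> (Suc t) $ s = closest_point prob_simplex (\<pi> t $ s - (\<eta> / 2) *\<^sub>R est t (\<pi> t) (x t) $ s)" for s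
    using assms(2) unfolding srpmd_def by (intro proximal_step_closest assms(1)) blast
  then show ?case
    by (simp add: vec_eq_iff Suc)
qed

lemma prob_simplex_nonempty: "(prob_simplex :: (real^'n) set) \<noteq> {}"
proof -
  have "(\<chi> i. 1 / real CARD('n)) \<in> (prob_simplex :: (real^'n) set)"
    by (simp add: prob_simplex_def)
  then show ?thesis by blast
qed

lemma srpmd_iter_policies:
  assumes "\<pi>0 \<in> policies"
  shows "srpmd_iter \<eta> est \<pi>0 t x \<in> policies"
proof (cases t)
  case (Suc t')
  then show ?thesis
    by (simp add: policies_def closest_point_in_set[OF closed_prob_simplex prob_simplex_nonempty])
qed (simp add: assms)

text \<open>The claims feed each other: an iterate and its sample give the estimate by joint
  measurability of \<open>est\<close>, and the continuous projection turns iterate and estimate into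
  the next iterate.\<close>

lemma measurable_srpmd_iter:
  fixes est :: "nat \<Rightarrow> ('s::finite, 'a::finite) policy \<Rightarrow> 'x \<Rightarrow> real^'a^'s"
  assumes est: "\<And>j. (\<lambda>(p, x). est j p x) \<in> borel_measurable (borel \<Otimes>\<^sub>M X j)"
  shows "srpmd_iter \<eta> est \<pi>0 t \<in> borel_measurable (PiM UNIV X)"
    and "(\<lambda>x. est t (srpmd_iter \<eta> est \<pi>0 t x) (x t)) \<in> borel_measurable (PiM UNIV X)"
proof -
  have est_iter: "(\<lambda>x. est t (srpmd_iter \<eta> est \<pi>0 t x) (x t)) \<in> borel_measurable (PiM UNIV X)"
    if "srpmd_iter \<eta> est \<pi>0 t \<in> borel_measurable (PiM UNIV X)" for t
  proof -
    have "(\<lambda>x. (srpmd_iter \<eta> est \<pi>0 t x, x t)) \<in> measurable (PiM UNIV X) (borel \<Otimes>\<^sub>M X t)"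
      by (intro measurable_Pair that measurable_component_singleton) auto
    from measurable_compose[OF this est] show ?thesis by simp
  qed
  show iter: "srpmd_iter \<eta> est \<pi>0 t \<in> borel_measurable (PiM UNIV X)"
  proof (induction t)
    case (Suc t)
    have cp: "closest_point prob_simplex \<in> borel_measurable (borel :: (real^'a) measure)"
      by (intro borel_measurable_continuous_onI continuous_on_closest_point convex_prob_simplex
          closed_prob_simplex prob_simplex_nonempty)
    have "(\<lambda>x. closest_point prob_simplex (srpmd_iter \<eta> est \<pi>0 t x $ s
        - (\<eta> / 2) *\<^sub>R est t (srpmd_iter \<eta> est \<pi>0 t x) (x t) $ s)) \<in> borel_measurable (PiM UNIV X)" for s
    proof (rule measurable_compose[OF _ cp])
      have "(\<lambda>x. srpmd_iter \<eta> est \<pi>0 t x $ s) \<in> borel_measurable (PiM UNIV X)"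
        using measurable_compose[OF Suc borel_measurable_vec_nth] .
      moreover have "(\<lambda>x. est t (srpmd_iter \<eta> est \<pi>0 t x) (x t) $ s) \<in> borel_measurable (PiM UNIV X)"
        using measurable_compose[OF est_iter[OF Suc] borel_measurable_vec_nth] .
      ultimately show "(\<lambda>x. srpmd_iter \<eta> est \<pi>0 t x $ s
          - (\<eta> / 2) *\<^sub>R est t (srpmd_iter \<eta> est \<pi>0 t x) (x t) $ s) \<in> borel_measurable (PiM UNIV X)"
        by simp
    qed
    then have "(\<lambda>x. srpmd_iter \<eta> est \<pi>0 (Suc t) x) \<in> borel_measurable (PiM UNIV X)"
      unfolding srpmd_iter.simps by (rule borel_measurable_vec_lambda)
    then show ?case by simp
  next
    case 0
    have "(\<lambda>x. srpmd_iter \<eta> est \<pi>0 0 x) \<in> borel_measurable (PiM UNIV X)"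
      by simp
    then show ?case by simp
  qed
  from est_iter[OF this]
  show "(\<lambda>x. est t (srpmd_iter \<eta> est \<pi>0 t x) (x t)) \<in> borel_measurable (PiM UNIV X)" .
qed

text \<open>Robust values are shown continuous on \<open>policies\<close> only, so \<open>g\<close>
  is regarded as a map into the subspace \<open>S\<close>.\<close>

lemma borel_measurable_compose_continuous_on:
  fixes h :: "'b::topological_space \<Rightarrow> 'c::topological_space"
  assumes "continuous_on S h" "g \<in> borel_measurable N" "\<And>x. g x \<in> S"
  shows "(\<lambda>x. h (g x)) \<in> borel_measurable N"
proof (rule measurable_compose[where N="restrict_space borel S" and g=h])
  show "g \<in> measurable N (restrict_space borel S)"
    using assms by (intro measurable_restrict_space2) auto
  show "h \<in> borel_measurable (restrict_space borel S)"
    by (rule borel_measurable_continuous_on_restrict[OF assms(1)])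
qed

section \<open>Averaging over an independent index\<close>

lemma sets_vimage_algebra_compose:
  assumes "Y \<in> \<Omega> \<rightarrow> space T" "h \<in> measurable T N"
  shows "sets (vimage_algebra \<Omega> (\<lambda>\<omega>. h (Y \<omega>)) N) \<subseteq> sets (vimage_algebra \<Omega> Y T)"
  by (rule sets_image_in_sets)
    (auto intro: measurable_compose[OF measurable_vimage_algebra1[OF assms(1)] assms(2)])

lemma (in prob_space) indep_var_of_indep_vimage:
  assumes "indep_set (sets (vimage_algebra (space M) X S)) (sets (vimage_algebra (space M) Y T))"
    and X: "X \<in> measurable M S" and Y: "Y \<in> measurable M T"
    and g: "g \<in> measurable S N" and h: "h \<in> measurable T N"
  shows "indep_var N (\<lambda>\<omega>. g (X \<omega>)) N (\<lambda>\<omega>. h (Y \<omega>))"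
proof -
  have "indep_set (sets (vimage_algebra (space M) (\<lambda>\<omega>. g (X \<omega>)) N))
      (sets (vimage_algebra (space M) (\<lambda>\<omega>. h (Y \<omega>)) N))"
    using assms(1) unfolding indep_set_def
  proof (rule indep_sets_mono_sets)
    have "X \<in> space M \<rightarrow> space S" "Y \<in> space M \<rightarrow> space T"
      using measurable_space[OF X] measurable_space[OF Y] by auto
    from sets_vimage_algebra_compose[OF this(1) g] sets_vimage_algebra_compose[OF this(2) h]
    show "case_bool (sets (vimage_algebra (space M) (\<lambda>\<omega>. g (X \<omega>)) N))
        (sets (vimage_algebra (space M) (\<lambda>\<omega>. h (Y \<omega>)) N)) i
      \<subseteq> case_bool (sets (vimage_algebra (space M) X S)) (sets (vimage_algebra (space M) Y T)) i" for i
      by (simp split: bool.split)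
  qed
  then show ?thesis
    unfolding indep_var_eq using measurable_compose[OF X g] measurable_compose[OF Y h]
    by (simp add: sets_vimage_algebra)
qed

text \<open>The random index is expanded into indicators of its values; by independence each product
  factors, and each indicator has mean \<open>1 / k\<close>.\<close>

lemma (in prob_space) expectation_uniform_index:
  fixes h :: "nat \<Rightarrow> 'c \<Rightarrow> real" and R :: "'a \<Rightarrow> nat" and T :: "'c measure" and k :: nat
  assumes R: "R \<in> measurable M (count_space UNIV)" and Y: "Y \<in> measurable M T"
    and indep: "indep_set (sets (vimage_algebra (space M) R (count_space UNIV)))
      (sets (vimage_algebra (space M) Y T))"
    and unif: "distr M (count_space UNIV) R = measure_pmf (pmf_of_set {1..k})" and k: "k \<ge> 1"
    and h: "\<And>t. h t \<in> borel_measurable T" and B: "\<And>t y. \<bar>h t y\<bar> \<le> B"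
  shows "expectation (\<lambda>\<omega>. h (R \<omega>) (Y \<omega>)) = (\<Sum>t=1..k. expectation (\<lambda>\<omega>. h t (Y \<omega>))) / k"
proof -
  have int: "integrable M (\<lambda>\<omega>. h t (Y \<omega>))" for t
    by (rule integrable_const_bound[of _ B]) (use B measurable_compose[OF Y h] in auto)
  have ind: "(\<lambda>r. of_bool (r = t) :: real) \<in> borel_measurable (count_space UNIV)" for t :: nat
    by simp
  have int': "integrable M (\<lambda>\<omega>. of_bool (R \<omega> = t) :: real)" for t
    by (rule integrable_const_bound[of _ 1]) (use measurable_compose[OF R ind] in auto)
  have prob: "expectation (\<lambda>\<omega>. of_bool (R \<omega> = t)) = 1 / k" if "t \<in> {1..k}" for t
  proof -
    have "expectation (\<lambda>\<omega>. of_bool (R \<omega> = t) :: real)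
        = integral\<^sup>L (distr M (count_space UNIV) R) (\<lambda>r. of_bool (r = t))"
      by (rule integral_distr[symmetric, OF R ind])
    also have "\<dots> = measure_pmf.expectation (pmf_of_set {1..k}) (indicator {t})"
      unfolding unif by (intro Bochner_Integration.integral_cong) (auto split: split_indicator)
    also have "\<dots> = 1 / k"
      using that by (simp add: measure_pmf_single)
    finally show ?thesis .
  qed
  have prod: "integrable M (\<lambda>\<omega>. of_bool (R \<omega> = t) * h t (Y \<omega>))"
    "expectation (\<lambda>\<omega>. of_bool (R \<omega> = t) * h t (Y \<omega>))
       = expectation (\<lambda>\<omega>. of_bool (R \<omega> = t)) * expectation (\<lambda>\<omega>. h t (Y \<omega>))" for t
  proof -
    have "indep_var borel (\<lambda>\<omega>. of_bool (R \<omega> = t) :: real) borel (\<lambda>\<omega>. h t (Y \<omega>))"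
      by (rule indep_var_of_indep_vimage[OF indep R Y ind h])
    from indep_var_integrable[OF this int' int] indep_var_lebesgue_integral[OF this int' int]
    show "integrable M (\<lambda>\<omega>. of_bool (R \<omega> = t) * h t (Y \<omega>))"
      "expectation (\<lambda>\<omega>. of_bool (R \<omega> = t) * h t (Y \<omega>))
       = expectation (\<lambda>\<omega>. of_bool (R \<omega> = t)) * expectation (\<lambda>\<omega>. h t (Y \<omega>))" by auto
  qed
  \<comment> \<open>Outside \<open>{1..k}\<close> all indicators vanish, so the expansion is claimed
    almost everywhere only.\<close>
  have "AE r in distr M (count_space UNIV) R. r \<in> {1..k}"
    unfolding unif using k by (simp add: AE_measure_pmf_iff)
  then have AE_R: "AE \<omega> in M. R \<omega> \<in> {1..k}"
    by (subst (asm) AE_distr_iff[OF R]) auto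
  have "expectation (\<lambda>\<omega>. h (R \<omega>) (Y \<omega>)) = expectation (\<lambda>\<omega>. \<Sum>t=1..k. of_bool (R \<omega> = t) * h t (Y \<omega>))"
  proof (rule integral_cong_AE)
    show "AE \<omega> in M. h (R \<omega>) (Y \<omega>) = (\<Sum>t=1..k. of_bool (R \<omega> = t) * h t (Y \<omega>))"
      using AE_R by eventually_elim (simp add: of_bool_def if_distrib[of "\<lambda>z. z * _"] cong: if_cong)
    show "(\<lambda>\<omega>. h (R \<omega>) (Y \<omega>)) \<in> borel_measurable M"
      by (rule measurable_compose_countable[OF measurable_compose[OF Y h] R])
    show "(\<lambda>\<omega>. \<Sum>t=1..k. of_bool (R \<omega> = t) * h t (Y \<omega>)) \<in> borel_measurable M"
      using prod(1) by (intro borel_measurable_sum) auto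
  qed
  also have "\<dots> = (\<Sum>t=1..k. expectation (\<lambda>\<omega>. of_bool (R \<omega> = t)) * expectation (\<lambda>\<omega>. h t (Y \<omega>)))"
    by (subst Bochner_Integration.integral_sum) (auto simp: prod)
  also have "\<dots> = (\<Sum>t=1..k. expectation (\<lambda>\<omega>. h t (Y \<omega>))) / k"
    by (simp add: prob sum_divide_distrib)
  finally show ?thesis .
qed

section \<open>Mean errors from conditional bounds\<close>

lemma enn2ereal_le_ereal_imp_nonneg:
  assumes "enn2ereal x \<le> ereal e"
  shows "0 \<le> e"
  using order_trans[OF enn2ereal_nonneg assms] by simp

text \<open>Testing the conditional expectation against the constant one recovers the full
  expectation. With nonnegative integrals, integrability is a consequence of the bound.\<close>

lemma (in prob_space) expectation_le_nn_cond_exp_bound: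
  fixes g :: "'a \<Rightarrow> real" and e :: real
  assumes sub: "subalgebra M F" and g: "g \<in> borel_measurable M" "\<And>\<omega>. 0 \<le> g \<omega>"
    and bound: "AE \<omega> in M. enn2ereal (nn_cond_exp M F (\<lambda>\<omega>. ennreal (g \<omega>)) \<omega>) \<le> ereal e"
  shows "integrable M g" "expectation g \<le> e" "0 \<le> e"
proof -
  interpret finite_measure_subalgebra M F
    using sub by unfold_locales
  let ?n = "nn_cond_exp M F (\<lambda>\<omega>. ennreal (g \<omega>))"
  have "AE \<omega> in M. 0 \<le> e"
    using bound by eventually_elim (rule enn2ereal_le_ereal_imp_nonneg)
  then show e: "0 \<le> e" by simp
  have "(\<integral>\<^sup>+\<omega>. ennreal (g \<omega>) \<partial>M) = (\<integral>\<^sup>+\<omega>. ?n \<omega> \<partial>M)"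
    using nn_cond_exp_intg[of "\<lambda>_. 1" "\<lambda>\<omega>. ennreal (g \<omega>)"] g(1) by simp
  also have "\<dots> \<le> (\<integral>\<^sup>+\<omega>. ennreal e \<partial>M)"
    by (rule nn_integral_mono_AE)
      (use bound e in \<open>auto simp: less_eq_ennreal.rep_eq enn2ereal_ennreal\<close>)
  also have "\<dots> = ennreal e"
    by (simp add: emeasure_space_1)
  finally have le: "(\<integral>\<^sup>+\<omega>. ennreal (g \<omega>) \<partial>M) \<le> ennreal e" .
  show int: "integrable M g"
    using le g by (intro integrableI_nonneg) (auto intro: le_less_trans)
  show "expectation g \<le> e"
    using le e g by (simp add: nn_integral_eq_integral[OF int])
qed

lemma subalgebra_past:
  assumes "\<And>j. \<xi> j \<in> measurable W (X j)"
  shows "subalgebra W (past W X \<xi> k)"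
  unfolding subalgebra_def past_def
proof
  show "sets (vimage_algebra (space W) (\<lambda>\<omega>. \<lambda>i\<in>{..<k}. \<xi> i \<omega>) (PiM {..<k} X)) \<subseteq> sets W"
    by (rule sets_image_in_sets[OF refl]) (intro measurable_restrict assms)
qed simp

text \<open>This linear majorant, taken at the bound for the mean, replaces Jensen's inequality.\<close>

lemma sqrt_le_tangent:
  fixes y b :: real
  assumes "0 < b" "0 \<le> y"
  shows "sqrt y \<le> (y + b) / (2 * sqrt b)"
proof -
  have "sqrt (y * b) \<le> (y + b) / 2"
    using assms by (intro arith_geo_mean_sqrt) auto
  then have "sqrt y \<le> (y + b) / 2 / sqrt b"
    using assms by (simp only: real_sqrt_mult pos_le_divide_eq real_sqrt_gt_zero)
  then show ?thesis
    by simp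
qed

theorem theorem4p2:
  fixes c :: "'s::finite \<Rightarrow> 'a::finite \<Rightarrow> real"
    and \<gamma> \<eta> :: real
    and PN :: "('s, 'a) kernel"
    and U :: "('s, 'a) kernel set"
    and \<rho> :: "real^'s"
    and \<pi>opt \<pi>0 :: "('s, 'a) policy"
    and W :: "'w measure"
    and X :: "nat \<Rightarrow> 'x measure"
    and \<xi> :: "nat \<Rightarrow> 'w \<Rightarrow> 'x"
    and est :: "nat \<Rightarrow> ('s, 'a) policy \<Rightarrow> 'x \<Rightarrow> real^'a^'s"
    and \<pi> :: "nat \<Rightarrow> 'w \<Rightarrow> ('s, 'a) policy"
    and k :: nat
    and R :: "'w \<Rightarrow> nat"
    and M :: real
    and f :: "('s, 'a) policy \<Rightarrow> real"
  defines "f \<equiv> f_obj c \<gamma> PN U \<rho>"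
  assumes mdp: "robust_mdp c \<gamma> PN U"
    and rho: "\<rho> \<in> prob_simplex"
    and opt: "optimal_robust c \<gamma> PN U \<pi>opt"
    and M: "mismatch \<gamma> PN U \<pi>opt \<rho> < \<infinity>" "M = enn2real (mismatch \<gamma> PN U \<pi>opt \<rho>)"
    and eta: "\<eta> > 0"
    and init: "\<pi>0 \<in> policies"
    and prob: "prob_space W"
    and samples: "\<And>j. \<xi> j \<in> measurable W (X j)"
    and est_meas: "\<And>j. (\<lambda>(p, x). est j p x) \<in> borel_measurable (borel \<Otimes>\<^sub>M X j)"
    and iterates: "\<And>\<omega>. \<omega> \<in> space W \<Longrightarrow>
          srpmd (\<lambda>_. \<eta>) est \<pi>0 (\<lambda>j. \<xi> j \<omega>) (\<lambda>j. \<pi> j \<omega>)"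
    and k: "k \<ge> 1"
    and R_uniform: "distr W (count_space UNIV) R = measure_pmf (pmf_of_set {1..k})"
    and R_meas: "R \<in> measurable W (count_space UNIV)"
    and R_indep: "prob_space.indep_set W
          (sets (vimage_algebra (space W) R (count_space UNIV)))
          (sets (vimage_algebra (space W) (\<lambda>\<omega> j. \<xi> j \<omega>) (PiM UNIV X)))"
  shows "(\<forall>e :: nat \<Rightarrow> real. (\<forall>j. AE \<omega> in W.
            enn2ereal (est_error c \<gamma> PN U W X \<xi> est \<pi> j \<omega>) \<le> ereal (e j))
        \<longrightarrow> (LINT \<omega>|W. f (\<pi> (R \<omega>) \<omega>) - f \<pi>opt)
          \<le> M / ((1 - \<gamma>) * k) * (f \<pi>0 - f \<pi>opt)
            + 4 * M / ((1 - \<gamma>)\<^sup>2 * k) * (\<Sum>t<k. e t)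
            + sqrt (18 * (real CARD('s))\<^sup>2 / (k * \<eta> * (1 - \<gamma>) ^ 3)) * sqrt (1 + 2 * (\<Sum>t<k. e t)))
    \<and> (\<forall>\<epsilon> :: real. (\<forall>j. AE \<omega> in W.
            enn2ereal (est_error c \<gamma> PN U W X \<xi> est \<pi> j \<omega>) \<le> ereal \<epsilon>)
        \<longrightarrow> (LINT \<omega>|W. f (\<pi> (R \<omega>) \<omega>) - f \<pi>opt)
          \<le> M / ((1 - \<gamma>) * k) * (f \<pi>0 - f \<pi>opt)
            + 4 * M * \<epsilon> / (1 - \<gamma>)\<^sup>2
            + sqrt (18 * (real CARD('s))\<^sup>2 / (\<eta> * k * (1 - \<gamma>) ^ 3))
            + sqrt (36 * (real CARD('s))\<^sup>2 * \<epsilon> / (\<eta> * (1 - \<gamma>) ^ 3)))"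
proof -
  interpret robust_mdp c \<gamma> PN U by (rule mdp)
  interpret W: prob_space W by (rule prob)
  note ctx = rho opt M
  let ?g = "1 - \<gamma>" and ?n = "real CARD('s)"
  have g: "0 < ?g"
    using discount by simp
  have M0: "0 \<le> M"
    using M_ge_1[OF ctx] by simp
  \<comment> \<open>The pathwise bound has \<open>4 * ?n\<close> under the root; since there is at
    least one state, the stated \<open>18 * ?n\<^sup>2\<close> dominates it.\<close>
  have n2: "4 * ?n \<le> 18 * ?n\<^sup>2"
  proof -
    have n1: "1 \<le> ?n"
      by simp
    then have "?n * 1 \<le> ?n * ?n"
      by (intro mult_left_mono) auto
    with n1 show ?thesis
      unfolding power2_eq_square by linarith
  qed
  define \<Xi> where "\<Xi> \<omega> = (\<lambda>j. \<xi> j \<omega>)" for \<omega>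
  define G where "G = srpmd_iter \<eta> est \<pi>0"
  have iter: "\<pi> t \<omega> = G t (\<Xi> \<omega>)" if "\<omega> \<in> space W" for t \<omega>
    unfolding G_def \<Xi>_def by (rule srpmd_eq_iter[OF eta iterates[OF that]])
  have G_pol: "G t x \<in> policies" for t x
    unfolding G_def by (rule srpmd_iter_policies[OF init])
  have G_meas: "G t \<in> borel_measurable (PiM UNIV X)"
    "(\<lambda>x. est t (G t x) (x t)) \<in> borel_measurable (PiM UNIV X)" for t
    unfolding G_def by (rule measurable_srpmd_iter[OF est_meas])+
  have \<Xi>_meas: "\<Xi> \<in> measurable W (PiM UNIV X)"
    unfolding \<Xi>_def using samples by (intro measurable_PiM_single') (auto dest: measurable_space)
  define h where "h t x = f (G t x) - f \<pi>opt" for t x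
  have h_meas: "h t \<in> borel_measurable (PiM UNIV X)" for t
  proof -
    have "continuous_on policies f"
      unfolding f_def f_obj_def by (intro continuous_intros V_continuous)
    from borel_measurable_compose_continuous_on[OF this G_meas(1) G_pol]
    show ?thesis unfolding h_def by simp
  qed
  \<comment> \<open>Uniform in \<open>t\<close>, so that it also covers the random index.\<close>
  have h_bound: "\<bar>h t x\<bar> \<le> 1 / ?g" for t x
    using f_bounds[OF ctx G_pol, of t x] f_bounds[OF ctx opt_policy[OF ctx]]
    unfolding h_def f_def by linarith
  have "(LINT \<omega>|W. f (\<pi> (R \<omega>) \<omega>) - f \<pi>opt) = (LINT \<omega>|W. h (R \<omega>) (\<Xi> \<omega>))"
    by (intro Bochner_Integration.integral_cong) (auto simp: h_def iter)
  also have "\<dots> = (\<Sum>t=1..k. LINT \<omega>|W. h t (\<Xi> \<omega>)) / k"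
    by (rule W.expectation_uniform_index[OF R_meas \<Xi>_meas R_indep[folded \<Xi>_def[abs_def]] R_uniform k h_meas h_bound])
  finally have average: "(LINT \<omega>|W. f (\<pi> (R \<omega>) \<omega>) - f \<pi>opt) = (\<Sum>t=1..k. LINT \<omega>|W. h t (\<Xi> \<omega>)) / k" .
  define \<delta> where "\<delta> t \<omega> = infnorm (est t (\<pi> t \<omega>) (\<xi> t \<omega>) - Q (\<pi> t \<omega>))" for t \<omega>
  have \<delta>_meas: "\<delta> t \<in> borel_measurable W" for t
  proof -
    have Q_meas: "(\<lambda>x. Q (G t x)) \<in> borel_measurable (PiM UNIV X)"
      by (rule borel_measurable_compose_continuous_on[OF Q_continuous G_meas(1) G_pol])
    have inf_meas: "infnorm \<in> borel_measurable (borel :: (real^'a^'s) measure)"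
      by (intro borel_measurable_continuous_onI continuous_on_infnorm continuous_on_id)
    have "(\<lambda>x. infnorm (est t (G t x) (x t) - Q (G t x))) \<in> borel_measurable (PiM UNIV X)"
      using G_meas(2) Q_meas by (intro measurable_compose[OF _ inf_meas] borel_measurable_diff)
    from measurable_compose[OF \<Xi>_meas this]
    have "(\<lambda>\<omega>. infnorm (est t (G t (\<Xi> \<omega>)) (\<xi> t \<omega>) - Q (G t (\<Xi> \<omega>)))) \<in> borel_measurable W"
      by (simp add: \<Xi>_def)
    then show ?thesis
      \<comment> \<open>The iterates agree with the explicit recursion on \<open>space W\<close>,
        which is all that measurability sees.\<close>
      by (rule measurable_cong[THEN iffD1, rotated]) (simp add: \<delta>_def iter)
  qed
  have int_h: "integrable W (\<lambda>\<omega>. h t (\<Xi> \<omega>))" for t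
    by (rule W.integrable_const_bound[of _ "1 / ?g"])
      (use h_bound measurable_compose[OF \<Xi>_meas h_meas] in auto)
  have main: "(LINT \<omega>|W. f (\<pi> (R \<omega>) \<omega>) - f \<pi>opt)
      \<le> M / (?g * k) * (f \<pi>0 - f \<pi>opt) + 4 * M / (?g\<^sup>2 * k) * (\<Sum>t<k. e t)
        + sqrt (18 * ?n\<^sup>2 / (k * \<eta> * ?g ^ 3)) * sqrt (1 + 2 * (\<Sum>t<k. e t))"
    if e: "\<forall>j. AE \<omega> in W. enn2ereal (est_error c \<gamma> PN U W X \<xi> est \<pi> j \<omega>) \<le> ereal (e j)" for e
  proof -
    have \<delta>: "integrable W (\<delta> t)" "W.expectation (\<delta> t) \<le> e t" "0 \<le> e t" for t
    proof -
      have "AE \<omega> in W. enn2ereal (nn_cond_exp W (past W X \<xi> t) (\<lambda>\<omega>. ennreal (\<delta> t \<omega>)) \<omega>) \<le> ereal (e t)"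
        using e unfolding est_error_def \<delta>_def by blast
      note bound = W.expectation_le_nn_cond_exp_bound[OF subalgebra_past[OF samples] \<delta>_meas _ this]
      have "0 \<le> \<delta> t \<omega>" for \<omega>
        by (simp add: \<delta>_def infnorm_pos_le)
      then show "integrable W (\<delta> t)" "W.expectation (\<delta> t) \<le> e t" "0 \<le> e t"
        by (rule bound)+
    qed
    define D where "D \<omega> = (\<Sum>t<k. \<delta> t \<omega>)" for \<omega>
    define S where "S = (\<Sum>t<k. e t)"
    define C where "C = sqrt (4 * k * ?n / (\<eta> * ?g ^ 3))"
    have S0: "0 \<le> S"
      unfolding S_def using \<delta>(3) by (intro sum_nonneg) auto
    have C0: "0 \<le> C"
      unfolding C_def using eta g by simp
    have D_int: "integrable W D" and D_le: "W.expectation D \<le> S"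
      unfolding D_def[abs_def] S_def using \<delta>
      by (auto simp: Bochner_Integration.integral_sum intro!: sum_mono)
    let ?A = "M / ?g * (f \<pi>0 - f \<pi>opt)" and ?B = "2 * M / ?g\<^sup>2" and ?b = "1 + 2 * S"
    \<comment> \<open>The right-hand side is affine in \<open>D\<close>, so its expectation involves
      the error only through its mean. The tangent meets the root at \<open>?b\<close>, so replacing
      that mean by \<open>S\<close> gives back exactly \<open>sqrt ?b\<close>.\<close>
    have path: "(\<Sum>t=1..k. h t (\<Xi> \<omega>)) \<le> ?A + ?B * D \<omega> + C * ((1 + 2 * D \<omega> + ?b) / (2 * sqrt ?b))"
      if \<omega>: "\<omega> \<in> space W" for \<omega>
    proof -
      have \<pi>0: "\<pi> 0 \<omega> = \<pi>0"
        using iterates[OF \<omega>] by (simp add: srpmd_def)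
      have "0 \<le> D \<omega>"
        unfolding D_def \<delta>_def by (intro sum_nonneg infnorm_pos_le)
      then have "sqrt (1 + 2 * D \<omega>) \<le> (1 + 2 * D \<omega> + ?b) / (2 * sqrt ?b)"
        using S0 by (intro sqrt_le_tangent) auto
      then have tangent: "C * sqrt (1 + 2 * D \<omega>) \<le> C * ((1 + 2 * D \<omega> + ?b) / (2 * sqrt ?b))"
        using C0 by (rule mult_left_mono)
      have "(\<Sum>t=1..k. f (\<pi> t \<omega>) - f \<pi>opt) \<le> ?A + ?B * D \<omega> + C * sqrt (1 + 2 * D \<omega>)"
        using pathwise_bound[OF ctx eta _ iterates[OF \<omega>], of k] init
        by (simp add: \<pi>0 f_def D_def \<delta>_def C_def)
      then show ?thesis
        using tangent \<omega> by (simp add: h_def iter)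
    qed
    have "(\<Sum>t=1..k. LINT \<omega>|W. h t (\<Xi> \<omega>)) = (LINT \<omega>|W. (\<Sum>t=1..k. h t (\<Xi> \<omega>)))"
      by (rule Bochner_Integration.integral_sum[symmetric]) (rule int_h)
    also have "\<dots> \<le> (LINT \<omega>|W. ?A + ?B * D \<omega> + C * ((1 + 2 * D \<omega> + ?b) / (2 * sqrt ?b)))"
      using D_int int_h by (intro integral_mono path Bochner_Integration.integrable_sum) auto
    also have "\<dots> = ?A + ?B * W.expectation D + C * ((1 + 2 * W.expectation D + ?b) / (2 * sqrt ?b))"
      using D_int by (simp add: W.prob_space)
    also have "\<dots> \<le> ?A + 4 * M / ?g\<^sup>2 * S + C * ((?b + ?b) / (2 * sqrt ?b))"
    proof -
      have "?B * W.expectation D \<le> ?B * S"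
        using M0 D_le by (intro mult_left_mono) auto
      \<comment> \<open>The pathwise factor 2 is relaxed to the stated 4.\<close>
      also have "\<dots> \<le> 4 * M / ?g\<^sup>2 * S"
        using M0 S0 by (intro mult_right_mono divide_right_mono) auto
      finally have "?B * W.expectation D \<le> 4 * M / ?g\<^sup>2 * S" .
      moreover have "C * ((1 + 2 * W.expectation D + ?b) / (2 * sqrt ?b)) \<le> C * ((?b + ?b) / (2 * sqrt ?b))"
        using C0 S0 D_le by (intro mult_left_mono divide_right_mono) auto
      ultimately show ?thesis by linarith
    qed
    also have "(?b + ?b) / (2 * sqrt ?b) = sqrt ?b"
      using S0 by (simp add: field_simps)
    finally have "(LINT \<omega>|W. f (\<pi> (R \<omega>) \<omega>) - f \<pi>opt) \<le> (?A + 4 * M / ?g\<^sup>2 * S + C * sqrt ?b) / k"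
      unfolding average by (rule divide_right_mono) simp
    also have "\<dots> = M / (?g * k) * (f \<pi>0 - f \<pi>opt) + 4 * M / (?g\<^sup>2 * k) * S + C / k * sqrt ?b"
      by (simp add: add_divide_distrib)
    \<comment> \<open>Squaring \<open>C / k\<close> moves the single \<open>k\<close> in the
      numerator of \<open>C\<close> to the denominator; the rest is \<open>n2\<close>.\<close>
    also have "C / k \<le> sqrt (18 * ?n\<^sup>2 / (k * \<eta> * ?g ^ 3))"
    proof (rule real_le_rsqrt)
      have "(C / k)\<^sup>2 = 4 * ?n / (k * \<eta> * ?g ^ 3)"
        unfolding C_def using k eta g by (simp add: power_divide power2_eq_square)
      also have "\<dots> \<le> 18 * ?n\<^sup>2 / (k * \<eta> * ?g ^ 3)"
        using n2 k eta g by (intro divide_right_mono) auto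
      finally show "(C / k)\<^sup>2 \<le> 18 * ?n\<^sup>2 / (k * \<eta> * ?g ^ 3)" .
    qed
    finally show ?thesis
      using S0 by (simp add: S_def mult_right_mono)
  qed
  have const: "(LINT \<omega>|W. f (\<pi> (R \<omega>) \<omega>) - f \<pi>opt)
      \<le> M / (?g * k) * (f \<pi>0 - f \<pi>opt) + 4 * M * \<epsilon> / ?g\<^sup>2
        + sqrt (18 * ?n\<^sup>2 / (\<eta> * k * ?g ^ 3)) + sqrt (36 * ?n\<^sup>2 * \<epsilon> / (\<eta> * ?g ^ 3))"
    if e: "\<forall>j. AE \<omega> in W. enn2ereal (est_error c \<gamma> PN U W X \<xi> est \<pi> j \<omega>) \<le> ereal \<epsilon>" for \<epsilon>
  proof -
    have "AE \<omega> in W. 0 \<le> \<epsilon>"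
      using e[rule_format, of 0] by eventually_elim (rule enn2ereal_le_ereal_imp_nonneg)
    then have \<epsilon>: "0 \<le> \<epsilon>" by simp
    let ?a = "18 * ?n\<^sup>2 / (\<eta> * ?g ^ 3)"
    \<comment> \<open>Constant errors add up to \<open>k * \<epsilon>\<close>, which cancels the
      \<open>k\<close> in the denominator; the error part of the root therefore does not decay with
      \<open>k\<close>.\<close>
    have "sqrt (18 * ?n\<^sup>2 / (k * \<eta> * ?g ^ 3)) * sqrt (1 + 2 * (\<Sum>t<k. \<epsilon>)) = sqrt (?a / k + 2 * ?a * \<epsilon>)"
      unfolding real_sqrt_mult[symmetric] using k eta g
      by (intro arg_cong[where f=sqrt]) (simp add: field_simps)
    also have "\<dots> \<le> sqrt (?a / k) + sqrt (2 * ?a * \<epsilon>)"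
      using eta g \<epsilon> by (intro sqrt_add_le_add_sqrt) auto
    finally have "sqrt (18 * ?n\<^sup>2 / (k * \<eta> * ?g ^ 3)) * sqrt (1 + 2 * (\<Sum>t<k. \<epsilon>))
        \<le> sqrt (18 * ?n\<^sup>2 / (\<eta> * k * ?g ^ 3)) + sqrt (36 * ?n\<^sup>2 * \<epsilon> / (\<eta> * ?g ^ 3))"
      by (simp add: mult_ac)
    moreover have "4 * M / (?g\<^sup>2 * k) * (\<Sum>t<k. \<epsilon>) = 4 * M * \<epsilon> / ?g\<^sup>2"
      using k by simp
    ultimately show ?thesis
      using main[of "\<lambda>_. \<epsilon>", OF e] by linarith
  qed
  show ?thesis
    using main const by blast
qed

end
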